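(* Let $\mathcal{C}$ be a connected simply connected Cartan scheme of rank two with $I=\{1,2\}$ and object set $A$, such that $\mathcal{R}^{\mathrm{re}}(\mathcal{C})$ is a finite irreducible root system. Put $n=|A|/2$. Let $a\in A$ and $c=\Phi(1,a)$. Let $\pi:\mathcal{C}\to\mathcal{C}'$ be the covering for which $\mathrm{End}(\pi(a))$ is maximal. Write $c=d^r$ for a sequence $d$ and $r\in\mathbb{N}$ such that $r$ is maximal, and let $m=|A|/2r$ be the length of $d$. Then $r\in\{1,2,3\}$ and $\mathrm{End}(\pi(a))$ is given by the following subgroup of $H$. If $m$ is even and $c$ is of type 1: $Z_2\times Z_2$ for $r=1$, $\mathbb{D}_4$ for $r=2$, $\mathbb{D}_6$ for $r=3$. If $m$ is even and $c$ is of type 2: $Z_2=\langle\mu^{n}\rangle$ for $r=1$, $Z_4=\langle\mu^{n/2}\rangle$ for $r=2$, $Z_6=\langle\mu^{n/3}\rangle$ for $r=3$. If $m$ is odd and $c$ is of type 1: $Z_2$ for $r=1$, $Z_2\times Z_2$ for $r=2$, $Z_3\rtimes Z_2$ (nonabelian, i.e. dihedral of order 6) for $r=3$. If $m$ is odd and $c$ is of type 2: the trivial group for $r=1$, $Z_2=\langle\mu^{n}\rangle$ for $r=2$, $Z_3=\langle\mu^{2n/3}\rangle$ for $r=3$.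
   Context: Cartan schemes (rank two). Let $I=\{1,2\}$, $A$ a non-empty set, $\rho_i:A\to A$ a map for each $i\in I$, and $C^a=(c^a_{jk})_{j,k\in I}$ an integer matrix for each $a\in A$. The quadruple $\mathcal{C}=(I,A,(\rho_i)_{i\in I},(C^a)_{a\in A})$ is a Cartan scheme of rank two if every $C^a$ is a generalized Cartan matrix ($c^a_{ii}=2$; $c^a_{ij}\le 0$ for $i\ne j$; $c^a_{ij}=0$ implies $c^a_{ji}=0$), $\rho_i^2=\mathrm{id}$ for all $i$, and $c^a_{ij}=c^{\rho_i(a)}_{ij}$ for all $a\in A$, $i,j\in I$. Let $(\alpha_i)_{i\in I}$ be the standard basis of $\mathbb{Z}^I$ and let $\sigma_i^a\in\mathrm{Aut}(\mathbb{Z}^I)$, $\sigma_i^a(\alpha_j)=\alpha_j-c^a_{ij}\alpha_i$. The Weyl groupoid $\mathcal{W}(\mathcal{C})$ is the category with object set $A$ whose morphisms are generated by the maps $\sigma_i^a$, regarded as elements of $\mathrm{Hom}(a,\rho_i(a))$ (so $\mathrm{Hom}(a,b)$ is the set of linear maps obtained as compositions of such maps along a path from $a$ to $b$). $\mathcal{C}$ is connected if $\mathcal{W}(\mathcal{C})$ is connected, simply connected if $\mathrm{End}(a)$ is trivial for all $a\in A$, and irreducible if every $C^a$ is indecomposable. The real roots at $a$ are $R^a=\{\varphi(\alpha_i)\mid i\in I,\ \varphi\in\mathrm{Hom}(b,a),\ b\in A\}$, and $\mathcal{R}^{\mathrm{re}}(\mathcal{C})=(\mathcal{C},(R^a)_{a\in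 A})$. A family $(R^a)_{a\in A}$ of subsets of $\mathbb{Z}^I$ is a root system of type $\mathcal{C}$ if, with $R^a_+=R^a\cap\mathbb{N}_0^I$: (R1) $R^a=R^a_+\cup -R^a_+$; (R2) $R^a\cap\mathbb{Z}\alpha_i=\{\alpha_i,-\alpha_i\}$; (R3) $\sigma_i^a(R^a)=R^{\rho_i(a)}$; (R4) if $i\ne j$ and $m=|R^a\cap(\mathbb{N}_0\alpha_i+\mathbb{N}_0\alpha_j)|$ is finite then $(\rho_i\rho_j)^m(a)=a$. It is finite if all $R^a$ are finite, irreducible if $\mathcal{C}$ is irreducible. Object change diagram: the undirected graph with vertex set $A$ having, for each $i\in I$ and $a\in A$ with $\rho_i(a)\ne a$, exactly one edge labelled $i$ between $a$ and $\rho_i(a)$. Under the hypotheses of the statement it is known to be a cycle with $2n$ vertices. The map $\Phi$: for $i\in I$, $a\in A$, $I=\{i,j\}$, put $a_1=a$, $a_2=\rho_i(a_1)$, $a_3=\rho_j(a_2)$, $a_4=\rho_i(a_3)$, $\dots$ and $c_1=-c^{a_1}_{ij}$, $c_2=-c^{a_2}_{ji}$, $c_3=-c^{a_3}_{ij}$, $\dots$; then $\Phi(i,a)=(c_1,\dots,c_n)$. It is known that $c_{n+k}=c_k$ for $1\le k\le n$ and that $\Phi(i,a)$ is an $\eta$-sequence, where $\eta$-sequences are the sequences obtained recursively from $(1,1,1)$ by cyclic rotation, reversal, and the operation $(c_1,\dots,c_n)\mapsto(c_1+1,1,c_2+1,c_3,\dots,c_n)$. For a sequence $d$, $d^r$ denotes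 the $r$-fold repetition of $d$. An $\eta$-sequence $(a_1,\dots,a_n)$ is of type 1 if there exists $k$ such that $(a_k,\dots,a_n,a_1,\dots,a_{k-1})=(a_k,a_{k-1},\dots,a_1,a_n,\dots,a_{k+1})$; otherwise it is of type 2. Coverings: let $\mathcal{C}=(I,A,(\rho_i),(C^a))$ and $\mathcal{C}'=(I,A',(\rho'_i),(C'^a))$ be connected Cartan schemes. A covering $\pi:\mathcal{C}\to\mathcal{C}'$ is a map $\pi:A\to A'$ with $C'^{\pi(a)}=C^a$ for all $a\in A$ and $\pi\circ\rho_i=\rho'_i\circ\pi$ for all $i\in I$. The group $H$: let $Z_k$ be the cyclic group of order $k$ and $\mathbb{D}_k$ the dihedral group of order $2k$. $\mathbb{D}_{2n}=Z_{2n}\rtimes Z_2$ acts on the cycle (object change diagram) with $2n$ vertices; $\mu$ is the generator of $Z_{2n}$ rotating the diagram by one edge, and $\tau$ is the generator of $Z_2$, a reflection of the cycle fixing a vertex. $H=\{\mu^{2k},\tau\mu^{2k+1}\mid k\in\mathbb{Z}\}\le\mathbb{D}_{2n}$, which is the subgroup of elements preserving the edge labels. For a covering $\pi:\mathcal{C}\to\mathcal{C}'$ with $\mathcal{C}$ simply connected, $\mathrm{End}(\pi(a))$ is identified with the subgroup $\{g\in H\mid \pi\circ g=\pi\}$ of $H$, whose orbits on $A$ are the fibres of $\pi$. *)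

theory Defs
  imports "HOL-Analysis.Analysis" "HOL-Algebra.Algebra"
begin

section \<open>Cartan schemes of rank two\<close>

text \<open>The index set \<open>I = {1, 2}\<close> is the two-element type \<^typ>\<open>2\<close> (whose elements are
  \<open>1\<close> and \<open>2\<close>), and \<open>\<int>\<^sup>I\<close> is \<^typ>\<open>int ^ 2\<close>. The entry \<open>c\<^sup>a\<^bsub>ij\<^esub>\<close> is \<open>cmat C a $ i $ j\<close>.\<close>

record 'a cscheme =
  objs :: "'a set"
  rho :: "2 \<Rightarrow> 'a \<Rightarrow> 'a"
  cmat :: "'a \<Rightarrow> int ^ 2 ^ 2"

definition gen_cartan_matrix :: "int ^ 2 ^ 2 \<Rightarrow> bool" where
  "gen_cartan_matrix M \<longleftrightarrow>
     (\<forall>i. M $ i $ i = 2) \<and>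
     (\<forall>i j. i \<noteq> j \<longrightarrow> M $ i $ j \<le> 0) \<and>
     (\<forall>i j. M $ i $ j = 0 \<longrightarrow> M $ j $ i = 0)"

definition indecomposable :: "int ^ 2 ^ 2 \<Rightarrow> bool" where
  "indecomposable M \<longleftrightarrow>
     \<not> (\<exists>J. J \<noteq> {} \<and> J \<noteq> UNIV \<and> (\<forall>j\<in>J. \<forall>k\<in>- J. M $ j $ k = 0 \<and> M $ k $ j = 0))"

definition cartan_scheme :: "'a cscheme \<Rightarrow> bool" where
  "cartan_scheme C \<longleftrightarrow>
     objs C \<noteq> {} \<and>
     (\<forall>i. rho C i \<in> objs C \<rightarrow> objs C) \<and>
     (\<forall>a\<in>objs C. gen_cartan_matrix (cmat C a)) \<and>
     (\<forall>i. \<forall>a\<in>objs C. rho C i (rho C i a) = a) \<and>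
     (\<forall>a\<in>objs C. \<forall>i j. cmat C a $ i $ j = cmat C (rho C i a) $ i $ j)"

definition irreducible_scheme :: "'a cscheme \<Rightarrow> bool" where
  "irreducible_scheme C \<longleftrightarrow> (\<forall>a\<in>objs C. indecomposable (cmat C a))"


section \<open>The Weyl groupoid and real roots\<close>

definition \<alpha> :: "2 \<Rightarrow> int ^ 2" where
  "\<alpha> i = axis i 1"

text \<open>The linear extension of \<open>\<alpha>\<^sub>j \<mapsto> \<alpha>\<^sub>j - c\<^sup>a\<^bsub>ij\<^esub> \<alpha>\<^sub>i\<close>; see the lemma following the definition.\<close>

definition \<sigma> :: "'a cscheme \<Rightarrow> 2 \<Rightarrow> 'a \<Rightarrow> int ^ 2 \<Rightarrow> int ^ 2" where
  "\<sigma> C i a x = x - (\<Sum>j\<in>UNIV. cmat C a $ i $ j * x $ j) *s \<alpha> i"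

lemma \<sigma>_\<alpha>: "\<sigma> C i a (\<alpha> j) = \<alpha> j - (cmat C a $ i $ j) *s \<alpha> i"
  by (simp add: \<sigma>_def \<alpha>_def axis_def if_distrib[of "\<lambda>t. _ * t"] cong: if_cong)

text \<open>\<open>Hom C a\<close> collects all morphisms with source \<open>a\<close>, paired with their target.\<close>

inductive_set Hom :: "'a cscheme \<Rightarrow> 'a \<Rightarrow> ('a \<times> (int ^ 2 \<Rightarrow> int ^ 2)) set"
  for C :: "'a cscheme" and a :: 'a where
  Hom_id: "a \<in> objs C \<Longrightarrow> (a, id) \<in> Hom C a"
| Hom_step: "(b, f) \<in> Hom C a \<Longrightarrow> (rho C i b, \<sigma> C i b \<circ> f) \<in> Hom C a"

definition weyl_hom :: "'a cscheme \<Rightarrow> 'a \<Rightarrow> 'a \<Rightarrow> (int ^ 2 \<Rightarrow> int ^ 2) set" where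
  "weyl_hom C a b = {f. (b, f) \<in> Hom C a}"

definition weyl_End :: "'a cscheme \<Rightarrow> 'a \<Rightarrow> (int ^ 2 \<Rightarrow> int ^ 2) monoid" where
  "weyl_End C a = \<lparr>carrier = weyl_hom C a a, mult = (\<circ>), one = id\<rparr>"

definition connected_scheme :: "'a cscheme \<Rightarrow> bool" where
  "connected_scheme C \<longleftrightarrow> (\<forall>a\<in>objs C. \<forall>b\<in>objs C. weyl_hom C a b \<noteq> {})"

definition simply_connected_scheme :: "'a cscheme \<Rightarrow> bool" where
  "simply_connected_scheme C \<longleftrightarrow> (\<forall>a\<in>objs C. weyl_hom C a a = {id})"

definition real_roots :: "'a cscheme \<Rightarrow> 'a \<Rightarrow> (int ^ 2) set" where
  "real_roots C a = {\<phi> (\<alpha> i) | \<phi> i b. b \<in> objs C \<and> \<phi> \<in> weyl_hom C b a}"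

definition nonneg_vecs :: "(int ^ 2) set" where
  "nonneg_vecs = {x. \<forall>i. 0 \<le> x $ i}"

definition root_system :: "'a cscheme \<Rightarrow> ('a \<Rightarrow> (int ^ 2) set) \<Rightarrow> bool" where
  "root_system C R \<longleftrightarrow>
     (\<forall>a\<in>objs C. R a = (R a \<inter> nonneg_vecs) \<union> uminus ` (R a \<inter> nonneg_vecs)) \<and>
     (\<forall>a\<in>objs C. \<forall>i. R a \<inter> range (\<lambda>k. k *s \<alpha> i) = {\<alpha> i, - \<alpha> i}) \<and>
     (\<forall>a\<in>objs C. \<forall>i. \<sigma> C i a ` R a = R (rho C i a)) \<and>
     (\<forall>a\<in>objs C. \<forall>i j.
        let S = R a \<inter> {int k *s \<alpha> i + int l *s \<alpha> j | k l. True}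
        in i \<noteq> j \<longrightarrow> finite S \<longrightarrow> ((rho C i \<circ> rho C j) ^^ card S) a = a)"

definition finite_irreducible_root_system ::
    "'a cscheme \<Rightarrow> ('a \<Rightarrow> (int ^ 2) set) \<Rightarrow> bool" where
  "finite_irreducible_root_system C R \<longleftrightarrow>
     root_system C R \<and> (\<forall>a\<in>objs C. finite (R a)) \<and> irreducible_scheme C"


section \<open>The sequence attached to an object\<close>

definition other :: "2 \<Rightarrow> 2" where
  "other i = (if i = 1 then 2 else 1)"

definition alt :: "2 \<Rightarrow> nat \<Rightarrow> 2" where
  "alt i k = (if even k then i else other i)"

text \<open>With indices starting from 0: \<open>walk C i a k\<close> is the object \<open>a\<^bsub>k+1\<^esub>\<close> of the sequence
  \<open>a, \<rho>\<^sub>i(a), \<rho>\<^sub>j(\<rho>\<^sub>i(a)), \<dots>\<close>.\<close>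

primrec walk :: "'a cscheme \<Rightarrow> 2 \<Rightarrow> 'a \<Rightarrow> nat \<Rightarrow> 'a" where
  "walk C i a 0 = a"
| "walk C i a (Suc k) = rho C (alt i k) (walk C i a k)"

definition Phi :: "'a cscheme \<Rightarrow> 2 \<Rightarrow> 'a \<Rightarrow> int list" where
  "Phi C i a =
     map (\<lambda>k. - (cmat C (walk C i a k) $ alt i k $ alt i (Suc k))) [0..<card (objs C) div 2]"

text \<open>\<open>(a\<^sub>k, \<dots>, a\<^sub>n, a\<^sub>1, \<dots>, a\<^bsub>k-1\<^esub>)\<close> is \<open>rotate (k - 1) xs\<close>, and
  \<open>(a\<^sub>k, \<dots>, a\<^sub>1, a\<^sub>n, \<dots>, a\<^bsub>k+1\<^esub>)\<close> is the reversal of \<open>rotate k xs\<close>.\<close>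

definition type1 :: "int list \<Rightarrow> bool" where
  "type1 xs \<longleftrightarrow> (\<exists>k\<in>{1..length xs}. rotate (k - 1) xs = rev (rotate k xs))"

abbreviation type2 :: "int list \<Rightarrow> bool" where
  "type2 xs \<equiv> \<not> type1 xs"

definition seq_pow :: "int list \<Rightarrow> nat \<Rightarrow> int list" where
  "seq_pow d r = concat (replicate r d)"


section \<open>Coverings\<close>

definition scheme_covering :: "'a cscheme \<Rightarrow> 'b cscheme \<Rightarrow> ('a \<Rightarrow> 'b) \<Rightarrow> bool" where
  "scheme_covering C C' p \<longleftrightarrow>
     cartan_scheme C \<and> connected_scheme C \<and> cartan_scheme C' \<and> connected_scheme C' \<and>
     p \<in> objs C \<rightarrow> objs C' \<and>
     (\<forall>a\<in>objs C. cmat C' (p a) = cmat C a) \<and>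
     (\<forall>i. \<forall>a\<in>objs C. p (rho C i a) = rho C' i (p a))"

text \<open>The groups \<open>End(p(a))\<close>, for all coverings \<open>p\<close> of \<open>C\<close>, are subgroups of \<open>Aut(\<int>\<^sup>I)\<close>, so
  maximality is meant with respect to inclusion. Connectedness of the target makes coverings
  surjective, hence up to isomorphism all targets have their objects in the type \<open>'a\<close>.\<close>

definition maximal_covering ::
    "'a cscheme \<Rightarrow> 'b cscheme \<Rightarrow> ('a \<Rightarrow> 'b) \<Rightarrow> 'a \<Rightarrow> bool" where
  "maximal_covering C C' p a \<longleftrightarrow>
     scheme_covering C C' p \<and>
     (\<forall>(C'' :: 'a cscheme) q. scheme_covering C C'' q \<longrightarrow>
        weyl_hom C' (p a) (p a) \<subseteq> weyl_hom C'' (q a) (q a) \<longrightarrow>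
        weyl_hom C'' (q a) (q a) = weyl_hom C' (p a) (p a))"


section \<open>Symmetries of the object change diagram\<close>

text \<open>When the object change diagram is the cycle \<open>a\<^sub>1, \<dots>, a\<^bsub>2n\<^esub>\<close>, numbered from \<open>a\<^sub>1 = a\<close> so
  that \<open>a\<^sub>2 = \<rho>\<^sub>1(a)\<close>, its symmetries act on the vertices as elements of \<^term>\<open>BijGroup (objs C)\<close>.
  Here \<open>\<mu>\<close> maps \<open>a\<^sub>k\<close> to \<open>a\<^bsub>k+1\<^esub>\<close>, and \<open>\<tau>\<close> maps \<open>a\<^bsub>1+k\<^esub>\<close> to \<open>a\<^bsub>1-k\<^esub>\<close>, the object reached
  from \<open>a\<close> by \<open>k\<close> steps in the opposite direction. The subgroup \<open>H\<close> does not depend on the choice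
  of the base vertex \<open>a\<close>.\<close>

definition position :: "'a cscheme \<Rightarrow> 'a \<Rightarrow> 'a \<Rightarrow> nat" where
  "position C a b = (LEAST k. walk C 1 a k = b)"

definition \<mu> :: "'a cscheme \<Rightarrow> 'a \<Rightarrow> 'a \<Rightarrow> 'a" where
  "\<mu> C a = (\<lambda>b\<in>objs C. walk C 1 a (Suc (position C a b)))"

definition \<tau> :: "'a cscheme \<Rightarrow> 'a \<Rightarrow> 'a \<Rightarrow> 'a" where
  "\<tau> C a = (\<lambda>b\<in>objs C. walk C 2 a (position C a b))"

definition H_set :: "'a cscheme \<Rightarrow> 'a \<Rightarrow> ('a \<Rightarrow> 'a) set" where
  "H_set C a =
     (let B = BijGroup (objs C) in
      {\<mu> C a [^]\<^bsub>B\<^esub> (2 * k) | k :: int. True} \<union>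
      {\<tau> C a \<otimes>\<^bsub>B\<^esub> \<mu> C a [^]\<^bsub>B\<^esub> (2 * k + 1) | k :: int. True})"

definition H_group :: "'a cscheme \<Rightarrow> 'a \<Rightarrow> ('a \<Rightarrow> 'a) monoid" where
  "H_group C a = (BijGroup (objs C))\<lparr>carrier := H_set C a\<rparr>"

definition deck_set :: "'a cscheme \<Rightarrow> 'a \<Rightarrow> ('a \<Rightarrow> 'b) \<Rightarrow> ('a \<Rightarrow> 'a) set" where
  "deck_set C a p = {g \<in> H_set C a. \<forall>b\<in>objs C. p (g b) = p b}"

definition deck_group :: "'a cscheme \<Rightarrow> 'a \<Rightarrow> ('a \<Rightarrow> 'b) \<Rightarrow> ('a \<Rightarrow> 'a) monoid" where
  "deck_group C a p = (BijGroup (objs C))\<lparr>carrier := deck_set C a p\<rparr>"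

text \<open>The identification of the subgroup \<open>{g \<in> H. p \<circ> g = p}\<close> with \<open>End(p(a))\<close>: the element \<open>g\<close>
  corresponds to the unique morphism from \<open>g(a)\<close> to \<open>a\<close> in the Weyl groupoid of the simply
  connected scheme \<open>C\<close>, whose image under the covering is an endomorphism of \<open>p(g(a)) = p(a)\<close>.
  (With morphisms from \<open>a\<close> to \<open>g(a)\<close> one would get an antihomomorphism.)\<close>

definition deck_to_End :: "'a cscheme \<Rightarrow> 'a \<Rightarrow> ('a \<Rightarrow> 'a) \<Rightarrow> int ^ 2 \<Rightarrow> int ^ 2" where
  "deck_to_End C a g = (THE f. f \<in> weyl_hom C (g a) a)"


section \<open>Abstract groups\<close>

abbreviation Z :: "nat \<Rightarrow> int monoid" where
  "Z k \<equiv> integer_mod_group k"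

text \<open>The semidirect product of \<open>Z k\<close> by \<open>Z 2\<close> acting by inversion, of order \<open>2 k\<close>.\<close>

definition dihedral :: "nat \<Rightarrow> (int \<times> int) monoid" where
  "dihedral k =
     \<lparr>carrier = carrier (Z k) \<times> carrier (Z 2),
      mult = (\<lambda>(x, s) (y, t). ((if s = 0 then x + y else x - y) mod int k, (s + t) mod 2)),
      one = (0, 0)\<rparr>"

end

(* Write beta_k for the image at a of the simple root that is reflected at the k-th step of the walk
   a, rho_1(a), rho_2(rho_1(a)), ... . Then beta_{k+1} = c_{k+1} beta_k - beta_{k-1} (indices of c from 1),
   and consecutive roots have determinant 1. Up to the first negative one, the beta_k enumerate the
   positive roots in order of slope, so there are N = |R_+| of them, beta_N = -beta_0, and by (R4)
   and simple connectedness the walk closes up exactly after 2N steps. Hence n = N, c has period n,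
   and shifting by a period m of c acts on the roots by some G in SL_2(Z) with G^r = -1, where n = mr;
   positivity of the second coordinates of beta_m, ..., beta_{(r-1)m} leaves only r = 1, 2, 3.

   The maximal covering identifies two objects whenever all words in the rho_i lead from them to equal
   Cartan matrices, so its deck group consists of all elements of H that preserve the Cartan matrices.
   Numbering the objects along the cycle, the Cartan matrix of the k-th one is given by c_k and c_{k-1},
   so rotations in the deck group are the even periods of c, and its reflections
   are the symmetries of c about an entry, which is the type 1 condition. *)

theory Submission
  imports Defs
begin

section \<open>Morphisms of the Weyl groupoid\<close>

text \<open>Maximality speaks of groups of linear maps belonging to different schemes. To compare
  them, everything is moved into the fixed group H. This needs a linear map into \<open>a\<close> to
  determine its source, which is not automatic, because morphisms do not remember their objects; it
  follows from the exact length of the cycle. Then \<open>deck_to_End\<close> is injective on H and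
  inclusions between End groups become inclusions between deck sets. The bound on r comes from an
  integer trace t: at multiples of m the second coordinates satisfy z(k+2) = t z(k+1) - z(k), and t
  \<ge> 2 would make them grow forever, whereas they vanish at k = r. The parity of m matters
  because H contains only the rotations by an even number of edges. The rotations of the deck group
  are therefore the multiples of lcm(2, m), and there are 2r or r of them.\<close>

lemma other_other [simp]: "other (other i) = i"
  using exhaust_2[of i] by (auto simp: other_def)

lemma other_neq [simp]: "other i \<noteq> i" "i \<noteq> other i"
  using exhaust_2[of i] by (auto simp: other_def)

lemma index_cases: "j = i \<or> j = other i"
  using exhaust_2[of i] exhaust_2[of j] by (auto simp: other_def)

lemma all_index: "(\<forall>j. P j) \<longleftrightarrow> P i \<and> P (other i)"
  by (metis index_cases)

lemma vec2_eq_iff: "(x :: 'b ^ 2) = y \<longleftrightarrow> x $ i = y $ i \<and> x $ other i = y $ other i"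
  unfolding vec_eq_iff by (rule all_index)

lemma alt_Suc [simp]: "alt i (Suc k) = other (alt i k)"
  by (simp add: alt_def)

lemma alt_0 [simp]: "alt i 0 = i"
  by (simp add: alt_def)

lemma alt_alt [simp]: "alt (alt i k) l = alt i (k + l)"
  by (induction k arbitrary: i) (auto simp: alt_def)

lemma \<alpha>_nth [simp]: "\<alpha> i $ i = 1" "\<alpha> i $ other i = 0" "\<alpha> (other i) $ i = 0"
  by (simp_all add: \<alpha>_def axis_def)

lemma nonneg_vecs_iff: "x \<in> nonneg_vecs \<longleftrightarrow> 0 \<le> x $ i \<and> 0 \<le> x $ other i"
  unfolding nonneg_vecs_def using all_index[of "\<lambda>i. 0 \<le> x $ i"] by simp

abbreviation coef :: "'a cscheme \<Rightarrow> 2 \<Rightarrow> 'a \<Rightarrow> int" where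
  "coef C i a \<equiv> - (cmat C a $ i $ other i)"

locale cartan =
  fixes C :: "'a cscheme"
  assumes cartan: "cartan_scheme C"
begin

lemma rho_closed [simp]: "a \<in> objs C \<Longrightarrow> rho C i a \<in> objs C"
  using cartan by (auto simp: cartan_scheme_def)

lemma rho_rho [simp]: "a \<in> objs C \<Longrightarrow> rho C i (rho C i a) = a"
  using cartan by (auto simp: cartan_scheme_def)

lemma cmat_diag [simp]: "a \<in> objs C \<Longrightarrow> cmat C a $ i $ i = 2"
  using cartan by (auto simp: cartan_scheme_def gen_cartan_matrix_def)

lemma cmat_rho: "a \<in> objs C \<Longrightarrow> cmat C (rho C i a) $ i $ j = cmat C a $ i $ j"
  using cartan unfolding cartan_scheme_def by metis

lemma \<sigma>_nth_other [simp]: "\<sigma> C i a x $ other i = x $ other i"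
  by (simp add: \<sigma>_def)

lemma \<sigma>_nth [simp]: "a \<in> objs C \<Longrightarrow> \<sigma> C i a x $ i = coef C i a * x $ other i - x $ i"
proof -
  have "(\<Sum>j\<in>UNIV. cmat C a $ i $ j * x $ j) = cmat C a $ i $ i * x $ i + cmat C a $ i $ other i * x $ other i"
    using exhaust_2[of i] by (auto simp: sum_2 other_def)
  then show "a \<in> objs C \<Longrightarrow> ?thesis" by (simp add: \<sigma>_def)
qed

lemma \<sigma>_lin: "\<sigma> C i a (x + t *s y) = \<sigma> C i a x + t *s \<sigma> C i a y"
  by (simp add: \<sigma>_def vec_eq_iff sum.distrib sum_distrib_left algebra_simps)

lemma \<sigma>_rho: "a \<in> objs C \<Longrightarrow> \<sigma> C i (rho C i a) = \<sigma> C i a"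
  by (simp add: \<sigma>_def cmat_rho fun_eq_iff)

lemma \<sigma>_\<sigma> [simp]: "a \<in> objs C \<Longrightarrow> \<sigma> C i a (\<sigma> C i a x) = x"
  by (simp add: vec2_eq_iff[of _ _ i])

lemma walk_closed [simp]: "a \<in> objs C \<Longrightarrow> walk C i a k \<in> objs C"
  by (induction k) auto

lemma walk_add: "walk C i a (k + l) = walk C (alt i k) (walk C i a k) l"
  by (induction l) auto

lemma Hom_target: "(b, f) \<in> Hom C a \<Longrightarrow> b \<in> objs C"
  by (induction b f rule: Hom.induct) auto

lemma Hom_source: "(b, f) \<in> Hom C a \<Longrightarrow> a \<in> objs C"
  by (induction b f rule: Hom.induct) auto

lemma Hom_comp:
  assumes "(c, g) \<in> Hom C b" "(b, f) \<in> Hom C a"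
  shows "(c, g \<circ> f) \<in> Hom C a"
  using assms by (induction c g rule: Hom.induct) (auto simp: comp_assoc intro: Hom.intros)

lemma Hom_\<sigma>: "a \<in> objs C \<Longrightarrow> (rho C i a, \<sigma> C i a) \<in> Hom C a"
  using Hom_step[OF Hom_id, of a C i] by simp

text \<open>A path is inverted by walking it backwards. This works because \<open>rho C i b\<close>
  carries the same i-th reflection as \<open>b\<close>: row i of the Cartan matrix agrees at both
  objects.\<close>

lemma Hom_inverse:
  assumes "(b, f) \<in> Hom C a"
  shows "\<exists>g. (a, g) \<in> Hom C b \<and> g \<circ> f = id \<and> f \<circ> g = id"
  using assms
proof (induction b f rule: Hom.induct)
  case Hom_id
  then show ?case using Hom.Hom_id[of a C] by fastforce
next
  case (Hom_step b f i)
  then obtain g where g: "(a, g) \<in> Hom C b" "g \<circ> f = id" "f \<circ> g = id" by blast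
  have b: "b \<in> objs C" using Hom_target Hom_step by blast
  have "(b, \<sigma> C i b) \<in> Hom C (rho C i b)"
    using Hom_\<sigma>[of "rho C i b" i] b by (simp add: \<sigma>_rho)
  from Hom_comp[OF g(1) this] have "(a, g \<circ> \<sigma> C i b) \<in> Hom C (rho C i b)" .
  moreover have "(g \<circ> \<sigma> C i b) \<circ> (\<sigma> C i b \<circ> f) = id" "(\<sigma> C i b \<circ> f) \<circ> (g \<circ> \<sigma> C i b) = id"
    using g(2,3) b by (auto simp: fun_eq_iff)
  ultimately show ?case by blast
qed

lemma Hom_lin: "(b, f) \<in> Hom C a \<Longrightarrow> f (x + t *s y) = f x + t *s f y"
  by (induction b f rule: Hom.induct) (auto simp: \<sigma>_lin)

lemma real_roots_Hom:
  assumes "x \<in> real_roots C a" "(b, f) \<in> Hom C a"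
  shows "f x \<in> real_roots C b"
proof -
  obtain \<phi> i c where \<phi>: "x = \<phi> (\<alpha> i)" "c \<in> objs C" "(a, \<phi>) \<in> Hom C c"
    using assms(1) by (auto simp: real_roots_def weyl_hom_def)
  have "(b, f \<circ> \<phi>) \<in> Hom C c" using Hom_comp[OF assms(2) \<phi>(3)] .
  moreover have "f x = (f \<circ> \<phi>) (\<alpha> i)" using \<phi>(1) by simp
  ultimately show ?thesis using \<phi>(2) unfolding real_roots_def weyl_hom_def by blast
qed

end

lemma Hom_map:
  assumes "cartan C" "(b, f) \<in> Hom C a"
    and "p \<in> objs C \<rightarrow> objs D"
    and "\<And>x. x \<in> objs C \<Longrightarrow> cmat D (p x) = cmat C x"
    and "\<And>i x. x \<in> objs C \<Longrightarrow> p (rho C i x) = rho D i (p x)"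
  shows "(p b, f) \<in> Hom D (p a)"
  using assms(2)
proof (induction b f rule: Hom.induct)
  case Hom_id
  then have "p a \<in> objs D" using assms(3) by blast
  then show ?case by (rule Hom.Hom_id)
next
  case (Hom_step b f i)
  have b: "b \<in> objs C" using cartan.Hom_target[OF assms(1)] Hom_step by blast
  have "\<sigma> C i b = \<sigma> D i (p b)" using assms(4)[OF b] by (simp add: \<sigma>_def fun_eq_iff)
  then show ?case using Hom.Hom_step[OF Hom_step.IH, of i] assms(5)[OF b] by metis
qed

text \<open>The word of reflections downstairs is followed upstairs from the prescribed start
  \<open>a\<close>; equal Cartan matrices give equal linear maps.\<close>

lemma Hom_lift:
  assumes "cartan C" "(b', f) \<in> Hom D a'" "a' = p a" "a \<in> objs C"
    and "\<And>x. x \<in> objs C \<Longrightarrow> cmat D (p x) = cmat C x"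
    and "\<And>i x. x \<in> objs C \<Longrightarrow> p (rho C i x) = rho D i (p x)"
  shows "\<exists>b. p b = b' \<and> (b, f) \<in> Hom C a"
  using assms(2)
proof (induction b' f rule: Hom.induct)
  case Hom_id
  then show ?case using assms(3) Hom.Hom_id[OF assms(4)] by blast
next
  case (Hom_step b' f i)
  then obtain b where b: "p b = b'" "(b, f) \<in> Hom C a" by blast
  have "b \<in> objs C" using cartan.Hom_target[OF assms(1)] b by blast
  moreover from this have "\<sigma> C i b = \<sigma> D i (p b)" using assms(5) by (simp add: \<sigma>_def fun_eq_iff)
  ultimately show ?case using Hom.Hom_step[OF b(2), of i] assms(6) b(1) by metis
qed


section \<open>The roots along a walk\<close>

text \<open>Reflections are appended on the right, so this is the morphism from the k-th object back
  to \<open>a\<close>; it carries roots at that object to roots at \<open>a\<close>.\<close>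

primrec walk_mor :: "'a cscheme \<Rightarrow> 2 \<Rightarrow> 'a \<Rightarrow> nat \<Rightarrow> int ^ 2 \<Rightarrow> int ^ 2" where
  "walk_mor C i a 0 = id"
| "walk_mor C i a (Suc k) = walk_mor C i a k \<circ> \<sigma> C (alt i k) (walk C i a k)"

definition walk_root :: "'a cscheme \<Rightarrow> 2 \<Rightarrow> 'a \<Rightarrow> nat \<Rightarrow> int ^ 2" where
  "walk_root C i a k = walk_mor C i a k (\<alpha> (alt i k))"

abbreviation walk_coef :: "'a cscheme \<Rightarrow> 2 \<Rightarrow> 'a \<Rightarrow> nat \<Rightarrow> int" where
  "walk_coef C i a k \<equiv> coef C (alt i k) (walk C i a k)"

context cartan
begin

lemma Hom_walk: "a \<in> objs C \<Longrightarrow> (a, walk_mor C i a k) \<in> Hom C (walk C i a k)"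
proof (induction k)
  case 0
  show ?case using Hom_id[where C = C, OF 0] unfolding walk_mor.simps walk.simps .
next
  case (Suc k)
  then show ?case
    using Hom_comp[OF Suc.IH, of "\<sigma> C (alt i k) (walk C i a k)"] Hom_\<sigma>[of "walk C i a (Suc k)" "alt i k"]
    by (metis \<sigma>_rho rho_rho walk.simps(2) walk_closed walk_mor.simps(2))
qed

lemma walk_mor_add: "walk_mor C i a (k + l) = walk_mor C i a k \<circ> walk_mor C (alt i k) (walk C i a k) l"
  by (induction l) (auto simp: walk_add comp_assoc)

lemma walk_root_add: "walk_root C i a (k + l) = walk_mor C i a k (walk_root C (alt i k) (walk C i a k) l)"
  by (simp add: walk_root_def walk_mor_add)

lemma walk_mor_lin: "a \<in> objs C \<Longrightarrow> walk_mor C i a k (x + t *s y) = walk_mor C i a k x + t *s walk_mor C i a k y"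
  using Hom_lin[OF Hom_walk] .

lemma walk_mor_minus: "a \<in> objs C \<Longrightarrow> walk_mor C i a k (- x) = - walk_mor C i a k x"
proof -
  assume a: "a \<in> objs C"
  have "walk_mor C i a k 0 = 0" using walk_mor_lin[OF a, of i k 0 1 0] by simp
  moreover have m: "-1 *s y = - y" for y :: "int ^ 2" by (simp add: vec_eq_iff)
  ultimately show ?thesis using walk_mor_lin[OF a, of i k 0 "-1" x] unfolding m by simp
qed

lemma walk_mor_Suc_\<alpha>:
  assumes "a \<in> objs C"
  shows "walk_mor C i a (Suc k) (\<alpha> (alt i k)) = - walk_root C i a k"
proof -
  have "\<sigma> C (alt i k) (walk C i a k) (\<alpha> (alt i k)) = - \<alpha> (alt i k)"
    using assms by (simp add: vec2_eq_iff[of _ _ "alt i k"])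
  then show ?thesis using walk_mor_minus[OF assms] by (simp add: walk_root_def)
qed

lemma walk_root_0 [simp]: "walk_root C i a 0 = \<alpha> i"
  by (simp add: walk_root_def)

lemma walk_root_1:
  assumes "a \<in> objs C"
  shows "walk_root C i a (Suc 0) = \<alpha> (other i) + walk_coef C i a 0 *s \<alpha> i"
  using assms \<sigma>_nth_other[of i a "\<alpha> (other i)"]
  by (simp add: walk_root_def vec2_eq_iff[of _ _ i] del: \<sigma>_nth_other)

text \<open>The last reflection sends the previous simple root to itself plus a multiple of its own
  one. The walk up to there sends that previous simple root to minus root k, whence the minus
  sign.\<close>

lemma walk_root_Suc_Suc:
  assumes "a \<in> objs C"
  shows "walk_root C i a (Suc (Suc k)) = walk_coef C i a (Suc k) *s walk_root C i a (Suc k) - walk_root C i a k"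
proof -
  let ?j = "alt i (Suc k)" and ?b = "walk C i a (Suc k)"
  have "walk_root C i a (Suc (Suc k)) = walk_mor C i a (Suc k) (walk_root C ?j ?b (Suc 0))"
    using walk_root_add[of i a "Suc k" "Suc 0"] by simp
  also have "walk_root C ?j ?b (Suc 0) = \<alpha> (alt i k) + coef C ?j ?b *s \<alpha> ?j"
    using assms by (simp add: walk_root_1)
  also have "walk_mor C i a (Suc k) \<dots> = - walk_root C i a k + coef C ?j ?b *s walk_root C i a (Suc k)"
    unfolding walk_mor_lin[OF assms] walk_mor_Suc_\<alpha>[OF assms] walk_root_def ..
  finally show ?thesis by simp
qed

text \<open>The older term of the recursion has coefficient -1, so the Casorati determinant of the
  two coordinate sequences is constant; at the start it is 1.\<close>

lemma walk_root_casorati: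
  assumes "a \<in> objs C"
  shows "walk_root C i a k $ i * walk_root C i a (Suc k) $ other i
       - walk_root C i a k $ other i * walk_root C i a (Suc k) $ i = 1"
proof (induction k)
  case 0
  then show ?case using walk_root_1[OF assms] by (simp add: \<alpha>_def axis_def)
next
  case (Suc k)
  then show ?case by (simp add: walk_root_Suc_Suc[OF assms] algebra_simps)
qed

lemma walk_mor_expand:
  assumes "a \<in> objs C"
  shows "walk_mor C i a (Suc k) x =
    (x $ alt i (Suc k)) *s walk_root C i a (Suc k) - (x $ alt i k) *s walk_root C i a k"
proof -
  let ?j = "alt i (Suc k)"
  have x: "x = (0 + (x $ ?j) *s \<alpha> ?j) + (x $ alt i k) *s \<alpha> (alt i k)"
    by (simp add: vec2_eq_iff[of _ _ "alt i k"])
  have "walk_mor C i a (Suc k) 0 = 0"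
    using walk_mor_minus[OF assms, of i "Suc k" 0] by (simp add: vec_eq_iff)
  then have "walk_mor C i a (Suc k) x = (x $ ?j) *s walk_root C i a (Suc k)
      + (x $ alt i k) *s walk_mor C i a (Suc k) (\<alpha> (alt i k))"
    using walk_mor_lin[OF assms, of i "Suc k" "0 + (x $ ?j) *s \<alpha> ?j" "x $ alt i k" "\<alpha> (alt i k)"]
      walk_mor_lin[OF assms, of i "Suc k" 0 "x $ ?j" "\<alpha> ?j"] 
    unfolding x[symmetric] walk_root_def by simp
  then show ?thesis unfolding walk_mor_Suc_\<alpha>[OF assms] by (simp add: vec_eq_iff)
qed

end


text \<open>A cone inside the quadrant that contains both unit vectors is the whole quadrant, so its
  generators lie on the axes; the determinant makes them primitive and fixes which is which.\<close>

lemma unimodular_cone: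
  fixes u v U V s t s' t' :: int
  assumes nonneg: "u \<ge> 0" "v \<ge> 0" "U \<ge> 0" "V \<ge> 0" "s \<ge> 0" "t \<ge> 0" "s' \<ge> 0" "t' \<ge> 0"
    and det: "v * U - u * V = 1"
    and e: "s * U + t * u = 0" "s * V + t * v = 1" "s' * U + t' * u = 1" "s' * V + t' * v = 0"
  shows "u = 0 \<and> v = 1 \<and> U = 1 \<and> V = 0"
proof -
  have "u * V \<ge> 0" using nonneg by simp
  then have "v * U > 0" using det by linarith
  then have vU: "v > 0" "U > 0" using nonneg by (auto simp: zero_less_mult_iff)
  have "s * U = 0" "t * u = 0"
    using e(1) nonneg add_nonneg_eq_0_iff[of "s * U" "t * u"] by auto
  then have "s = 0" using vU by simp
  then have tv: "t * v = 1" using e(2) by simp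
  then have "v = 1" using vU by (simp add: zmult_eq_1_iff)
  moreover from tv have "u = 0" using \<open>t * u = 0\<close> by auto
  moreover from calculation have "U = 1" using det by simp
  moreover from calculation have "V = 0" using e nonneg by simp
  ultimately show ?thesis by simp
qed

section \<open>Positive roots as roots along a walk\<close>

locale finite_cscheme = cartan +
  assumes connected: "connected_scheme C"
    and simply_connected: "simply_connected_scheme C"
    and root_system: "finite_irreducible_root_system C (real_roots C)"
begin

definition pos_roots :: "'a \<Rightarrow> (int ^ 2) set" where
  "pos_roots a = real_roots C a \<inter> nonneg_vecs"

lemma real_roots_eq: "a \<in> objs C \<Longrightarrow> real_roots C a = pos_roots a \<union> uminus ` pos_roots a"
  using root_system unfolding finite_irreducible_root_system_def root_system_def pos_roots_def by blast

lemma finite_real_roots [simp]: "a \<in> objs C \<Longrightarrow> finite (real_roots C a)"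
  using root_system unfolding finite_irreducible_root_system_def by blast

lemma finite_pos_roots [simp]: "a \<in> objs C \<Longrightarrow> finite (pos_roots a)"
  by (simp add: pos_roots_def)

lemma \<alpha>_in_real_roots: "a \<in> objs C \<Longrightarrow> \<alpha> i \<in> real_roots C a"
  using Hom_id[of a C] unfolding real_roots_def weyl_hom_def by (auto intro!: exI[of _ id])

lemma real_root_axis:
  assumes "a \<in> objs C" "x \<in> real_roots C a" "x $ other i = 0"
  shows "x = \<alpha> i \<or> x = - \<alpha> i"
proof -
  have "x = (x $ i) *s \<alpha> i" using assms(3) by (simp add: vec2_eq_iff[of _ _ i])
  then have "x \<in> real_roots C a \<inter> range (\<lambda>k. k *s \<alpha> i)" using assms(2) by blast
  then show ?thesis
    using root_system assms(1) unfolding finite_irreducible_root_system_def root_system_def by blast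
qed

lemma \<sigma>_real_roots: "a \<in> objs C \<Longrightarrow> \<sigma> C i a ` real_roots C a = real_roots C (rho C i a)"
  using root_system unfolding finite_irreducible_root_system_def root_system_def by blast

lemma real_root_sign:
  "a \<in> objs C \<Longrightarrow> x \<in> real_roots C a \<Longrightarrow> x \<in> nonneg_vecs \<or> - x \<in> nonneg_vecs"
  using equalityD1[OF real_roots_eq, of a] by (auto simp: pos_roots_def)

lemma card_real_roots:
  assumes "a \<in> objs C"
  shows "card (real_roots C a) = 2 * card (pos_roots a)"
proof -
  have "x \<noteq> - y" if "x \<in> pos_roots a" "y \<in> pos_roots a" for x y
  proof
    assume eq: "x = - y"
    then have "x $ 1 = 0" "x $ other 1 = 0"
      using that by (auto simp: pos_roots_def nonneg_vecs_iff[of _ 1])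
    then have "x = 0" by (simp add: vec2_eq_iff[of _ _ 1])
    then show False
      using real_root_axis[OF assms, of x 1] that \<alpha>_nth(1)[of 1] by (auto simp: pos_roots_def)
  qed
  then have "pos_roots a \<inter> uminus ` pos_roots a = {}" by blast
  then show ?thesis
    using assms by (simp add: real_roots_eq card_Un_disjoint card_image inj_on_def)
qed

text \<open>By (R3) the reflection is a bijection between the two root sets, and each is twice as
  large as its positive part. A constant number of positive roots lets later arguments restart at
  any object of the walk.\<close>

lemma card_pos_roots_rho:
  assumes "a \<in> objs C"
  shows "card (pos_roots (rho C i a)) = card (pos_roots a)"
proof -
  have "inj_on (\<sigma> C i a) (real_roots C a)" by (metis \<sigma>_\<sigma>[OF assms] inj_onI)
  then have "card (real_roots C (rho C i a)) = card (real_roots C a)"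
    using card_image \<sigma>_real_roots[OF assms] by metis
  then show ?thesis using card_real_roots[OF assms] card_real_roots[of "rho C i a"] assms by simp
qed

lemma card_pos_roots_Hom:
  "(b, f) \<in> Hom C a \<Longrightarrow> card (pos_roots b) = card (pos_roots a)"
  by (induction b f rule: Hom.induct) (auto simp: card_pos_roots_rho dest: Hom_target)

lemma Hom_self: "(a, f) \<in> Hom C a \<Longrightarrow> f = id"
  using simply_connected Hom_source unfolding simply_connected_scheme_def weyl_hom_def by blast

lemma walk_double: "walk C i a (2 * k) = ((rho C (other i) \<circ> rho C i) ^^ k) a"
  by (induction k) (auto simp: alt_def)

text \<open>(R4) is applied to the pair \<open>other i\<close>, \<open>i\<close>, the order of
  composition in \<open>walk_double\<close>. In rank two the cone in (R4) is the whole quadrant, so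
  its exponent counts all positive roots.\<close>

lemma walk_card_pos_roots:
  assumes "a \<in> objs C"
  shows "walk C i a (2 * card (pos_roots a)) = a"
proof -
  let ?S = "real_roots C a \<inter> {int k *s \<alpha> (other i) + int l *s \<alpha> i | k l. True}"
  have "nonneg_vecs = {int k *s \<alpha> (other i) + int l *s \<alpha> i | k l. True}"
  proof (intro equalityI subsetI)
    fix x assume "x \<in> nonneg_vecs"
    then have "x = int (nat (x $ other i)) *s \<alpha> (other i) + int (nat (x $ i)) *s \<alpha> i"
      by (simp add: vec2_eq_iff[of _ _ i] nonneg_vecs_iff[of _ i])
    then show "x \<in> {int k *s \<alpha> (other i) + int l *s \<alpha> i | k l. True}"
      by (intro CollectI exI conjI TrueI)
  next
    fix x assume "x \<in> {int k *s \<alpha> (other i) + int l *s \<alpha> i | k l. True}"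
    then obtain k l where x: "x = int k *s \<alpha> (other i) + int l *s \<alpha> i" by blast
    show "x \<in> nonneg_vecs" unfolding x by (simp add: nonneg_vecs_iff[of _ i])
  qed
  then have S: "?S = pos_roots a" by (simp add: pos_roots_def)
  have "finite ?S \<longrightarrow> ((rho C (other i) \<circ> rho C i) ^^ card ?S) a = a"
    using root_system assms other_neq(1)[of i]
    unfolding finite_irreducible_root_system_def root_system_def Let_def by blast
  then show ?thesis using assms unfolding S walk_double by simp
qed

lemma walk_root_in_real_roots: "a \<in> objs C \<Longrightarrow> walk_root C i a k \<in> real_roots C a"
  unfolding walk_root_def by (rule real_roots_Hom[OF \<alpha>_in_real_roots Hom_walk]) auto

text \<open>A root at \<open>a\<close> is carried forward by the reflections of the walk, which are
  involutions. In this way the simple roots at \<open>a\<close> get expressed through the simple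
  roots at a later object.\<close>

lemma real_root_pull_back:
  assumes "a \<in> objs C" "x \<in> real_roots C a"
  shows "\<exists>y\<in>real_roots C (walk C i a k). x = walk_mor C i a k y"
proof (induction k)
  case 0
  then show ?case using assms by auto
next
  case (Suc k)
  then obtain y where y: "y \<in> real_roots C (walk C i a k)" "x = walk_mor C i a k y" by blast
  then have "\<sigma> C (alt i k) (walk C i a k) y \<in> real_roots C (walk C i a (Suc k))"
    using \<sigma>_real_roots[of "walk C i a k" "alt i k"] assms by auto
  then show ?case using y assms by (intro bexI) auto
qed

text \<open>Both simple roots of the object \<open>walk C i a (Suc K)\<close> are nonpositive when
  viewed at \<open>a\<close>. The simple roots at \<open>a\<close> therefore come from negative
  roots there, which makes them nonnegative combinations of root K and minus root K + 1, and
  \<open>unimodular_cone\<close> applies.\<close>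

lemma walk_root_first_negative:
  assumes a: "a \<in> objs C"
    and nonneg: "walk_root C i a K \<in> nonneg_vecs" and neg: "walk_root C i a (Suc K) \<notin> nonneg_vecs"
  shows "walk_root C i a K = \<alpha> (other i)" "walk_root C i a (Suc K) = - \<alpha> i"
proof -
  let ?x = "walk_root C i a K" and ?y = "- walk_root C i a (Suc K)"
  have y: "?y \<in> nonneg_vecs"
    using real_root_sign[OF a walk_root_in_real_roots[OF a]] neg by blast
  have cone: "\<exists>s t. s \<ge> 0 \<and> t \<ge> 0 \<and> z = s *s ?y + t *s ?x"
    if z: "z = \<alpha> i \<or> z = \<alpha> (other i)" for z
  proof -
    obtain w where w: "w \<in> real_roots C (walk C i a (Suc K))" "z = walk_mor C i a (Suc K) w"
      using real_root_pull_back[OF a] \<alpha>_in_real_roots[OF a] z by metis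
    let ?s = "- w $ alt i (Suc K)" and ?t = "- w $ alt i K"
    have eq: "z = ?s *s ?y + ?t *s ?x"
      unfolding w(2) walk_mor_expand[OF a] by (simp add: vec_eq_iff)
    have "w \<notin> nonneg_vecs"
    proof
      assume "w \<in> nonneg_vecs"
      then have "w $ alt i (Suc K) \<ge> 0" "w $ alt i K \<ge> 0" by (auto simp: nonneg_vecs_def)
      then have "z $ j \<le> 0" for j
      proof -
        have "?y $ j \<ge> 0" "?x $ j \<ge> 0" using y nonneg by (auto simp: nonneg_vecs_def)
        then have "w $ alt i (Suc K) * ?y $ j \<ge> 0" "w $ alt i K * ?x $ j \<ge> 0"
          using \<open>w $ alt i (Suc K) \<ge> 0\<close> \<open>w $ alt i K \<ge> 0\<close> by (metis mult_nonneg_nonneg)+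
        then show ?thesis unfolding eq by simp
      qed
      then show False using z \<alpha>_nth(1) by (metis not_one_le_zero)
    qed
    then have "- w \<in> nonneg_vecs" using real_root_sign w(1) a by (meson walk_closed)
    then have "?s \<ge> 0" "?t \<ge> 0" by (auto simp: nonneg_vecs_def)
    then show ?thesis using eq by blast
  qed
  obtain s t where st: "s \<ge> 0" "t \<ge> 0" "\<alpha> (other i) = s *s ?y + t *s ?x" using cone by blast
  obtain s' t' where st': "s' \<ge> 0" "t' \<ge> 0" "\<alpha> i = s' *s ?y + t' *s ?x" using cone by blast
  have "?x $ i = 0 \<and> ?x $ other i = 1 \<and> ?y $ i = 1 \<and> ?y $ other i = 0"
  proof (rule unimodular_cone)
    show "s * ?y $ i + t * ?x $ i = 0" "s * ?y $ other i + t * ?x $ other i = 1"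
      using arg_cong[OF st(3), of "\<lambda>x. x $ i"] arg_cong[OF st(3), of "\<lambda>x. x $ other i"] by simp_all
    show "s' * ?y $ i + t' * ?x $ i = 1" "s' * ?y $ other i + t' * ?x $ other i = 0"
      using arg_cong[OF st'(3), of "\<lambda>x. x $ i"] arg_cong[OF st'(3), of "\<lambda>x. x $ other i"] by simp_all
    show "?x $ other i * ?y $ i - ?x $ i * ?y $ other i = 1"
      using walk_root_casorati[OF a, of i K] by simp
  qed (use st st' y nonneg in \<open>auto simp: nonneg_vecs_def\<close>)
  then show "?x = \<alpha> (other i)" "walk_root C i a (Suc K) = - \<alpha> i"
    by (auto simp: vec2_eq_iff[of _ _ i] minus_equation_iff[of 1])
qed

text \<open>A reflection keeps every positive root positive except the simple one, so a positive root
  that the walk eventually makes negative is one of the roots along the walk.\<close>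

lemma pos_root_cases:
  assumes a: "a \<in> objs C" and x: "x \<in> pos_roots a"
  shows "(\<exists>l<k. x = walk_root C i a l) \<or> (\<exists>y\<in>pos_roots (walk C i a k). x = walk_mor C i a k y)"
proof (induction k)
  case 0
  then show ?case using x by auto
next
  case (Suc k)
  let ?b = "walk C i a k" and ?i = "alt i k"
  consider "\<exists>l<k. x = walk_root C i a l"
    | y where "y \<in> pos_roots ?b" "x = walk_mor C i a k y"
    using Suc by blast
  then show ?case
  proof cases
    case 1
    then show ?thesis using less_SucI by blast
  next
    case (2 y)
    have b: "?b \<in> objs C" using a by simp
    let ?z = "\<sigma> C ?i ?b y"
    have z: "?z \<in> real_roots C (walk C i a (Suc k))"
      using \<sigma>_real_roots[OF b, of ?i] 2 by (auto simp: pos_roots_def)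
    have "x = walk_mor C i a (Suc k) ?z" using 2 b by simp
    moreover have "x = walk_root C i a k" if "?z \<notin> nonneg_vecs"
    proof -
      have "- ?z \<in> nonneg_vecs" using real_root_sign z that a by (meson walk_closed)
      then have "y $ other ?i = 0"
        using 2(1) by (auto simp: nonneg_vecs_iff[of _ ?i] pos_roots_def)
      then have "y = \<alpha> ?i \<or> y = - \<alpha> ?i"
        using 2(1) by (intro real_root_axis[OF b]) (auto simp: pos_roots_def)
      moreover have "y $ ?i \<ge> 0" using 2(1) by (auto simp: nonneg_vecs_def pos_roots_def)
      ultimately have "y = \<alpha> ?i" by auto
      then show ?thesis using 2(2) by (simp add: walk_root_def)
    qed
    ultimately show ?thesis using z by (auto simp: pos_roots_def)
  qed
qed

text \<open>Within the quadrant slopes increase from one root to the next, hence between any two.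
  Determinants replace slopes because the first coordinate may vanish at K.\<close>

lemma walk_root_pos_det:
  assumes a: "a \<in> objs C" and nonneg: "\<And>k. k \<le> K \<Longrightarrow> walk_root C i a k \<in> nonneg_vecs"
    and "k < l" "l \<le> K"
  shows "walk_root C i a k $ i * walk_root C i a l $ other i
       - walk_root C i a k $ other i * walk_root C i a l $ i > 0"
proof -
  define u where "u k = walk_root C i a k $ i" for k
  define v where "v k = walk_root C i a k $ other i" for k
  have uv: "u k \<ge> 0" "v k \<ge> 0" if "k \<le> K" for k
    using nonneg[OF that] by (auto simp: u_def v_def nonneg_vecs_def)
  have det: "u k * v (Suc k) - v k * u (Suc k) = 1" for k
    unfolding u_def v_def using walk_root_casorati[OF a] .
  have u_pos: "u k > 0" if "k < K" for k
  proof -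
    have "v k * u (Suc k) \<ge> 0" using uv[of k] uv[of "Suc k"] that by simp
    then have "u k \<noteq> 0" using det[of k] by auto
    then show ?thesis using uv(1)[of k] that by simp
  qed
  have "l \<le> K \<longrightarrow> u k * v l - v k * u l > 0"
    using \<open>k < l\<close>
  proof (induction rule: strict_inc_induct[of k l "\<lambda>k. l \<le> K \<longrightarrow> u k * v l - v k * u l > 0"])
    case (base k)
    then show ?case using det[of k] by simp
  next
    case (step k)
    show ?case
    proof
      assume l: "l \<le> K"
      \<comment> \<open>The three-term relation between the 2x2 minors of the vectors k,
        \<open>Suc k\<close> and l; it joins the step from k to \<open>Suc k\<close> to the
        induction hypothesis.\<close>
      have "u (Suc k) * (u k * v l - v k * u l)
          = u l * (u k * v (Suc k) - v k * u (Suc k)) + u k * (u (Suc k) * v l - v (Suc k) * u l)"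
        by (simp add: algebra_simps)
      also have "\<dots> > 0"
        using det[of k] step uv(1)[of l] u_pos[of k] l by (intro add_nonneg_pos mult_pos_pos) auto
      finally show "u k * v l - v k * u l > 0"
        using u_pos[of "Suc k"] l step(1) by (simp add: zero_less_mult_iff)
    qed
  qed
  then show ?thesis using \<open>l \<le> K\<close> by (simp add: u_def v_def)
qed

text \<open>Positive determinants make the roots 0, ..., K distinct. No positive root is missed: by
  \<open>walk_root_first_negative\<close> the morphism of the next object sends its simple roots to
  negatives of simple roots, hence positive roots to nonpositive vectors.\<close>

lemma card_pos_roots_walk:
  assumes a: "a \<in> objs C"
    and nonneg: "\<And>k. k \<le> K \<Longrightarrow> walk_root C i a k \<in> nonneg_vecs"
    and neg: "walk_root C i a (Suc K) \<notin> nonneg_vecs"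
  shows "card (pos_roots a) = Suc K"
proof -
  have "inj_on (walk_root C i a) {..K}"
  proof (rule linorder_inj_onI)
    fix k l assume "k < l" "l \<in> {..K}"
    then show "walk_root C i a k \<noteq> walk_root C i a l"
      using walk_root_pos_det[OF a nonneg, of K k l] by (auto simp: mult.commute)
  qed auto
  moreover have "walk_root C i a ` {..K} = pos_roots a"
  proof (intro equalityI subsetI)
    fix x assume x: "x \<in> pos_roots a"
    have "x \<noteq> walk_mor C i a (Suc K) y" if "y \<in> pos_roots (walk C i a (Suc K))" for y
    proof
      assume eq: "x = walk_mor C i a (Suc K) y"
      have y: "y $ j \<ge> 0" for j using that by (auto simp: pos_roots_def nonneg_vecs_def)
      have "x $ i \<le> 0 \<and> x $ other i \<le> 0"
        using y unfolding eq walk_mor_expand[OF a]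
          walk_root_first_negative[OF a nonneg neg, OF order_refl] by simp
      moreover have "x $ i \<ge> 0 \<and> x $ other i \<ge> 0"
        using x by (auto simp: pos_roots_def nonneg_vecs_def)
      ultimately have "x = 0" by (simp add: vec2_eq_iff[of _ _ i])
      then show False using real_root_axis[OF a, of x 1] x \<alpha>_nth(1)[of 1] by (auto simp: pos_roots_def)
    qed
    then show "x \<in> walk_root C i a ` {..K}"
      using pos_root_cases[OF a x, of "Suc K" i] by (auto simp: less_Suc_eq_le)
  next
    fix x assume "x \<in> walk_root C i a ` {..K}"
    then show "x \<in> pos_roots a"
      using nonneg walk_root_in_real_roots[OF a] by (auto simp: pos_roots_def)
  qed
  ultimately show ?thesis by (metis card_image card_atMost)
qed

text \<open>A negative root must occur: by (R4) the walk returns after 2N steps, N being the number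
  of positive roots; simple connectedness makes its morphism the identity, so root 2N - 1 is minus a
  simple root. Counting up to the first negative root shows that this one has index N.\<close>

lemma walk_root_pos:
  assumes a: "a \<in> objs C"
  shows "k < card (pos_roots a) \<Longrightarrow> walk_root C i a k \<in> nonneg_vecs"
    and "walk_root C i a (card (pos_roots a) - 1) = \<alpha> (other i)"
    and "walk_root C i a (card (pos_roots a)) = - \<alpha> i"
proof -
  have "\<alpha> i \<in> pos_roots a"
    using \<alpha>_in_real_roots[OF a] by (auto simp: pos_roots_def nonneg_vecs_iff[of _ i])
  then have "card (pos_roots a) > 0" using card_gt_0_iff finite_pos_roots[OF a] by blast
  then obtain l where l: "2 * card (pos_roots a) = Suc l"
    by (metis Suc_pred nat_0_less_mult_iff pos2)
  have "(a, walk_mor C i a (Suc l)) \<in> Hom C a"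
    using Hom_walk[OF a, of i "Suc l"] walk_card_pos_roots[OF a, of i] l by metis
  then have "walk_mor C i a (Suc l) = id" by (rule Hom_self)
  then have "walk_root C i a l = - \<alpha> (alt i l)"
    using walk_mor_Suc_\<alpha>[OF a, of i l] by simp
  then have l_neg: "walk_root C i a l \<notin> nonneg_vecs"
    by (simp add: nonneg_vecs_iff[of _ "alt i l"])
  define K where "K = (LEAST k. walk_root C i a k \<notin> nonneg_vecs)"
  have K: "walk_root C i a K \<notin> nonneg_vecs"
    unfolding K_def by (rule LeastI[of _ l]) (rule l_neg)
  have below: "walk_root C i a k \<in> nonneg_vecs" if "k < K" for k
    using not_less_Least that unfolding K_def by blast
  have "K \<noteq> 0" using K by (metis walk_root_0 Int_iff \<open>\<alpha> i \<in> pos_roots a\<close> pos_roots_def)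
  then obtain K' where K': "K = Suc K'" by (metis not0_implies_Suc)
  have c: "card (pos_roots a) = K"
    using card_pos_roots_walk[OF a, of K' i] below K K' by simp
  show "k < card (pos_roots a) \<Longrightarrow> walk_root C i a k \<in> nonneg_vecs" using below c by simp
  show "walk_root C i a (card (pos_roots a) - 1) = \<alpha> (other i)"
    "walk_root C i a (card (pos_roots a)) = - \<alpha> i"
    unfolding c using walk_root_first_negative[OF a below K[unfolded K']] K' by simp_all
qed

end


section \<open>Closing of the walk, number of objects and periodicity\<close>

context finite_cscheme
begin

definition half :: nat where
  "half = card (objs C) div 2"

lemma card_pos_roots_walk_eq:
  "a \<in> objs C \<Longrightarrow> card (pos_roots (walk C i a k)) = card (pos_roots a)"
  using card_pos_roots_Hom[OF Hom_walk] by metis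

lemma card_pos_roots_ge_2:
  assumes "a \<in> objs C"
  shows "card (pos_roots a) \<ge> 2"
proof -
  have "\<alpha> i \<in> pos_roots a" for i
    using \<alpha>_in_real_roots[OF assms, of i] by (simp add: pos_roots_def nonneg_vecs_iff[of _ i])
  then have "card {\<alpha> 1, \<alpha> (other 1)} \<le> card (pos_roots a)"
    using assms by (intro card_mono) auto
  moreover have "\<alpha> 1 \<noteq> \<alpha> (other 1)" using \<alpha>_nth by (metis zero_neq_one)
  ultimately show ?thesis by simp
qed

lemma walk_root_add_card:
  assumes "a \<in> objs C"
  shows "walk_root C i a (k + card (pos_roots a)) = - walk_root C i a k"
proof -
  have "walk_root C (alt i k) (walk C i a k) (card (pos_roots a)) = - \<alpha> (alt i k)"
    using walk_root_pos(3)[of "walk C i a k" "alt i k"] assms by (simp add: card_pos_roots_walk_eq)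
  then show ?thesis unfolding walk_root_add by (simp add: walk_mor_minus[OF assms] walk_root_def)
qed

lemma walk_root_mod:
  assumes "a \<in> objs C"
  shows "walk_root C i a (k mod (2 * card (pos_roots a))) = walk_root C i a k"
proof -
  let ?N = "card (pos_roots a)"
  have "walk_root C i a (l + 2 * ?N) = walk_root C i a l" for l
    using walk_root_add_card[OF assms, of i l] walk_root_add_card[OF assms, of i "l + ?N"]
    by (simp add: mult_2 add.assoc)
  then have "walk_root C i a (l + q * (2 * ?N)) = walk_root C i a l" for l q
    by (induction q) (simp_all, metis add.assoc add.commute)
  from this[of "k mod (2 * ?N)" "k div (2 * ?N)"] show ?thesis unfolding mod_div_mult_eq ..
qed

text \<open>In the index the roots have period 2N: N nonnegative ones, then their negatives. For k >
  0 the identity morphism makes root k - 1 negative and root k positive, a change that happens only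
  where k is a multiple of 2N.\<close>

lemma walk_mor_eq_id:
  assumes a: "a \<in> objs C" and id: "walk_mor C i a k = id"
  shows "2 * card (pos_roots a) dvd k"
proof (rule ccontr)
  let ?N = "card (pos_roots a)"
  assume "\<not> 2 * ?N dvd k"
  then obtain s where s: "k mod (2 * ?N) = Suc s" by (metis mod_0_imp_dvd not0_implies_Suc)
  have "2 * ?N > 0" using card_pos_roots_ge_2[OF a] by simp
  then have s_less: "Suc s < 2 * ?N" unfolding s[symmetric] by simp
  have "k \<noteq> 0" using s by (intro notI) simp
  then obtain l where l: "k = Suc l" by (metis not0_implies_Suc)
  have "Suc (l mod (2 * ?N)) = Suc s"
    using s unfolding l by (metis mod_Suc Zero_not_Suc)
  then have "walk_root C i a s = walk_root C i a l" using walk_root_mod[OF a, of i l] by simp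
  also have "\<dots> = - \<alpha> (alt i l)"
    using walk_mor_Suc_\<alpha>[OF a, of i l] id unfolding l by (simp del: walk_mor.simps)
  finally have "walk_root C i a s \<notin> nonneg_vecs" by (simp add: nonneg_vecs_iff[of _ "alt i l"])
  then have "s \<ge> ?N" using walk_root_pos(1)[OF a, of s i] by (meson not_less)
  then have "walk_root C i a (Suc s) = - walk_root C i a (Suc s - ?N)"
    using walk_root_add_card[OF a, of i "Suc s - ?N"] by simp
  moreover have "walk_root C i a (Suc s) = \<alpha> (alt i k)"
    using walk_root_mod[OF a, of i k] s id by (simp add: walk_root_def)
  ultimately have "walk_root C i a (Suc s - ?N) = - \<alpha> (alt i k)" by simp
  then have "walk_root C i a (Suc s - ?N) \<notin> nonneg_vecs" by (simp add: nonneg_vecs_iff[of _ "alt i k"])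
  then show False using walk_root_pos(1)[OF a, of "Suc s - ?N" i] s_less by simp
qed

lemma walk_add_period:
  assumes "a \<in> objs C"
  shows "walk C i a (k + 2 * card (pos_roots a)) = walk C i a k"
  using walk_card_pos_roots[of "walk C i a k" "alt i k"] assms
  by (simp add: walk_add card_pos_roots_walk_eq)

lemma walk_eq_self:
  assumes a: "a \<in> objs C"
  shows "walk C i a k = a \<longleftrightarrow> 2 * card (pos_roots a) dvd k"
proof
  assume "walk C i a k = a"
  then have "walk_mor C i a k = id" using Hom_self Hom_walk[OF a] by metis
  then show "2 * card (pos_roots a) dvd k" by (rule walk_mor_eq_id[OF a])
next
  have "walk C i a (2 * card (pos_roots a) * q) = a" for q
    using walk_add_period[OF a, of i] by (induction q) (simp_all, metis add.commute)
  then show "2 * card (pos_roots a) dvd k \<Longrightarrow> walk C i a k = a" by (metis dvdE)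
qed

lemma walk_eq_iff_le:
  assumes "a \<in> objs C" "k \<le> l"
  shows "walk C i a k = walk C i a l \<longleftrightarrow> 2 * card (pos_roots a) dvd l - k"
  using walk_eq_self[of "walk C i a k" "alt i k" "l - k"] walk_add[of i a k "l - k"] assms
  by (auto simp: card_pos_roots_walk_eq)

lemma objs_eq_walk:
  assumes a: "a \<in> objs C"
  shows "objs C = range (walk C i a)"
proof (intro equalityI subsetI)
  fix b assume "b \<in> objs C"
  then obtain f where "(b, f) \<in> Hom C a"
    using connected a unfolding connected_scheme_def weyl_hom_def by blast
  then show "b \<in> range (walk C i a)"
  proof (induction b f rule: Hom.induct)
    case Hom_id
    show ?case using walk.simps(1)[of C i a] by (metis rangeI)
  next
    case (Hom_step b f j)
    then obtain k where k: "b = walk C i a k" by blast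
    \<comment> \<open>A full turn is added to make the index positive, so that the walk can also be
      followed one step backwards from \<open>b\<close>.\<close>
    have "k + 2 * card (pos_roots a) \<noteq> 0" using card_pos_roots_ge_2[OF a] by simp
    then obtain l where l: "b = walk C i a (Suc l)"
      using walk_add_period[OF a, of i k] k by (metis not0_implies_Suc)
    consider "j = alt i (Suc l)" | "j = alt i l" using index_cases[of j "alt i l"] by auto
    then show ?case
    proof cases
      case 1
      then have "rho C j b = walk C i a (Suc (Suc l))" by (simp add: l)
      then show ?thesis by (metis rangeI)
    next
      case 2
      then have "rho C j b = walk C i a l" using a by (simp add: l)
      then show ?thesis by (metis rangeI)
    qed
  qed
qed (use a in auto)

lemma card_objs:
  assumes a: "a \<in> objs C"
  shows "card (objs C) = 2 * card (pos_roots a)"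
proof -
  let ?p = "2 * card (pos_roots a)"
  have p: "?p > 0" using card_pos_roots_ge_2[OF a] by simp
  have mod: "walk C 1 a k = walk C 1 a (k mod ?p)" for k
    using walk_eq_iff_le[OF a, of "k mod ?p" k 1] by (metis dvd_minus_mod mod_less_eq_dividend)
  have "objs C = walk C 1 a ` {..<?p}"
  proof
    show "objs C \<subseteq> walk C 1 a ` {..<?p}"
    proof
      fix b assume "b \<in> objs C"
      then obtain k where "b = walk C 1 a k" using objs_eq_walk[OF a, of 1] by blast
      then have "b = walk C 1 a (k mod ?p)" using mod by metis
      moreover have "k mod ?p \<in> {..<?p}" using p by simp
      ultimately show "b \<in> walk C 1 a ` {..<?p}" by (rule image_eqI)
    qed
    show "walk C 1 a ` {..<?p} \<subseteq> objs C" using walk_closed[OF a] by blast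
  qed
  moreover have "inj_on (walk C 1 a) {..<?p}"
  proof (rule linorder_inj_onI)
    fix k l assume kl: "k < l" "l \<in> {..<?p}"
    then have "\<not> ?p dvd l - k" using dvd_imp_le[of ?p "l - k"] by (metis diff_le_self lessThan_iff leD
      le_less_trans zero_less_diff)
    then show "walk C 1 a k \<noteq> walk C 1 a l"
      using walk_eq_iff_le[OF a less_imp_le[OF kl(1)], of 1] by blast
  qed (rule nat_le_linear)
  ultimately show ?thesis by (metis card_image card_lessThan)
qed

lemma card_pos_roots: "a \<in> objs C \<Longrightarrow> card (pos_roots a) = half"
  unfolding half_def by (subst card_objs[of a]) simp_all

text \<open>With N = \<open>half\<close>, root N + 1 is computed twice: by the recursion from root N
  - 1, which is \<open>\<alpha> (other i)\<close>, and root N, which is \<open>- \<alpha> i\<close>;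
  and as minus root 1. Comparing i-th coordinates equates the coefficients at N and 0, and
  restarting at the k-th object gives the rest.\<close>

lemma walk_coef_add_half:
  assumes a: "a \<in> objs C"
  shows "walk_coef C i a (k + half) = walk_coef C i a k"
proof -
  have *: "walk_coef C i b half = walk_coef C i b 0" if b: "b \<in> objs C" for i b
  proof -
    obtain l where l: "half = Suc l"
      using card_pos_roots_ge_2[OF b] card_pos_roots[OF b] by (cases half) auto
    have "walk_root C i b l = \<alpha> (other i)" "walk_root C i b half = - \<alpha> i"
      using walk_root_pos(2,3)[OF b] by (simp_all add: card_pos_roots[OF b] l)
    moreover have "walk_root C i b (Suc half) = - walk_root C i b (Suc 0)"
      using walk_root_add_card[OF b, of i "Suc 0"] by (simp add: card_pos_roots[OF b])
    ultimately have "- (\<alpha> (other i) + walk_coef C i b 0 *s \<alpha> i)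
        = walk_coef C i b half *s (- \<alpha> i) - \<alpha> (other i)"
      using walk_root_Suc_Suc[OF b, of i l] walk_root_1[OF b, of i] l by metis
    from arg_cong[OF this, of "\<lambda>x. x $ i"] show ?thesis by simp
  qed
  show ?thesis using *[of "walk C i a k" "alt i k"] a by (simp add: walk_add)
qed

end


section \<open>The cycle of objects\<close>

locale based_cscheme = finite_cscheme +
  fixes a :: 'a
  assumes base: "a \<in> objs C"
begin

abbreviation period :: int where
  "period \<equiv> 2 * int half"

text \<open>All integers serve as indices, modulo 2n, so that steps backwards and reflections of the
  cycle become affine maps without case distinctions.\<close>

definition obj :: "int \<Rightarrow> 'a" where
  "obj k = walk C 1 a (nat (k mod period))"

text \<open>This labels the edge between \<open>obj k\<close> and \<open>obj (k + 1)\<close>; it is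
  well defined on the cycle because 2n is even.\<close>

definition label :: "int \<Rightarrow> 2" where
  "label k = (if even k then 1 else 2)"

text \<open>The n-periodic extension of \<open>Phi C 1 a\<close> to the integers, indexed from 0.
  The number \<open>cc k\<close> belongs to the edge between \<open>obj k\<close> and
  \<open>obj (k + 1)\<close>.\<close>

definition cc :: "int \<Rightarrow> int" where
  "cc k = coef C (label k) (obj k)"

lemma half_ge_2: "half \<ge> 2"
  using card_pos_roots_ge_2[OF base] card_pos_roots[OF base] by simp

lemma card_objs_half: "card (objs C) = 2 * half"
  using card_objs[OF base] card_pos_roots[OF base] by simp

lemma obj_nat: "obj (int k) = walk C 1 a k"
proof -
  have "nat (int k mod period) = k mod (2 * half)"
    by (metis nat_int of_nat_mod of_nat_mult of_nat_numeral)
  then show ?thesis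
    using walk_eq_iff_le[OF base, of "k mod (2 * half)" k 1] card_pos_roots[OF base]
    by (simp add: obj_def dvd_minus_mod)
qed

lemma obj_eq_iff: "obj k = obj l \<longleftrightarrow> k mod period = l mod period"
proof -
  have le: "x = y" if "walk C 1 a x = walk C 1 a y" "x \<le> y" "y < 2 * half" for x y
  proof -
    have "2 * half dvd y - x"
      using walk_eq_iff_le[OF base that(2), of 1] that(1) unfolding card_pos_roots[OF base] by blast
    then have "y - x = 0" using that(3) by (metis dvd_imp_le diff_le_self le_less_trans leD neq0_conv)
    then show ?thesis using that(2) by simp
  qed
  have *: "walk C 1 a x = walk C 1 a y \<longleftrightarrow> x = y" if "x < 2 * half" "y < 2 * half" for x y
    using le[of x y] le[of y x] that nat_le_linear[of x y] by metis
  have "nat (j mod period) < 2 * half" for j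
    using half_ge_2 by (simp add: nat_less_iff)
  then have "obj k = obj l \<longleftrightarrow> nat (k mod period) = nat (l mod period)"
    unfolding obj_def using * by blast
  then show ?thesis using half_ge_2 by (simp add: eq_nat_nat_iff)
qed

lemma obj_mod [simp]: "obj (k mod period) = obj k"
  by (simp add: obj_eq_iff)

lemma obj_0 [simp]: "obj 0 = a"
  using obj_nat[of 0] by simp

lemma obj_in [simp]: "obj k \<in> objs C"
  using base by (simp add: obj_def)

lemma objs_eq: "objs C = range obj"
proof -
  have "range (walk C 1 a) \<subseteq> range obj" by (metis obj_nat image_subsetI rangeI)
  then show ?thesis using objs_eq_walk[OF base, of 1] by auto
qed

lemma alt_label: "alt 1 k = label (int k)"
  by (simp add: alt_def label_def other_def)

lemma label_mod: "label (k mod period) = label k"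
  unfolding label_def by (metis dvd_mod_iff dvd_triv_left)

lemma label_add1: "label (k + 1) = other (label k)"
  by (simp add: label_def other_def)

lemma label_eq_iff: "label k = label l \<longleftrightarrow> even (k - l)"
  by (auto simp: label_def)

lemma nat_rep: "\<exists>l. k mod period = int l" 
  using half_ge_2 by (intro exI[of _ "nat (k mod period)"]) simp

lemma rho_label: "rho C (label k) (obj k) = obj (k + 1)"
proof -
  obtain l where l: "k mod period = int l" using nat_rep by blast
  have "obj (k + 1) = obj (k mod period + 1)" by (simp add: obj_eq_iff mod_simps)
  also have "\<dots> = walk C 1 a (Suc l)" using obj_nat[of "Suc l"] l by (simp add: add.commute)
  also have "\<dots> = rho C (label (k mod period)) (obj (k mod period))"
    by (simp only: l obj_nat walk.simps alt_label)
  finally show ?thesis by (simp add: label_mod)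
qed

lemma rho_other_label: "rho C (other (label k)) (obj k) = obj (k - 1)"
  using arg_cong[OF rho_label[of "k - 1"], of "rho C (label (k - 1))"] label_add1[of "k - 1"] by simp

lemma cc_nat: "cc (int k) = walk_coef C 1 a k"
  by (simp add: cc_def obj_nat alt_label)

lemma cc_mod: "cc (k mod period) = cc k"
  by (simp add: cc_def label_mod)

lemma cc_add_half: "cc (k + int half) = cc k"
proof -
  obtain l where l: "k mod period = int l" using nat_rep by blast
  have "cc (k + int half) = cc ((k mod period + int half) mod period)"
    unfolding cc_mod[of "k + int half", symmetric] by (simp add: mod_simps)
  also have "\<dots> = cc (int (l + half))" by (simp add: cc_mod l)
  also have "\<dots> = cc (int l)" unfolding cc_nat by (rule walk_coef_add_half[OF base])
  finally show ?thesis by (simp add: l[symmetric] cc_mod)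
qed

text \<open>The edge from k - 1 to k carries the other label, and a step along it preserves the row
  of that label, so the second entry can be read off at \<open>obj (k - 1)\<close>.\<close>

lemma cmat_obj:
  "cmat C (obj k) $ label k $ other (label k) = - cc k"
  "cmat C (obj k) $ other (label k) $ label k = - cc (k - 1)"
proof -
  show "cmat C (obj k) $ label k $ other (label k) = - cc k" by (simp add: cc_def)
  have "cmat C (obj k) $ label (k - 1) = cmat C (obj (k - 1)) $ label (k - 1)"
    using cmat_rho[of "obj (k - 1)" "label (k - 1)"] rho_label[of "k - 1"] by (simp add: vec_eq_iff)
  then show "cmat C (obj k) $ other (label k) $ label k = - cc (k - 1)"
    using label_add1[of "k - 1"] by (simp add: cc_def)
qed

lemma cmat_obj_eq_even:
  assumes "even (k - l)"
  shows "cmat C (obj k) = cmat C (obj l) \<longleftrightarrow> cc k = cc l \<and> cc (k - 1) = cc (l - 1)"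
proof -
  have "label l = label k" using assms by (simp add: label_eq_iff)
  then show ?thesis
    using cmat_obj[of k] cmat_obj[of l]
    by (auto simp: vec2_eq_iff[of _ _ "label k"])
qed

text \<open>At odd distance the two labels are exchanged, and with them the roles of the
  off-diagonal entries.\<close>

lemma cmat_obj_eq_odd:
  assumes "odd (k - l)"
  shows "cmat C (obj k) = cmat C (obj l) \<longleftrightarrow> cc k = cc (l - 1) \<and> cc (k - 1) = cc l"
proof -
  have "label l = other (label k)" using assms by (auto simp: label_def other_def)
  then show ?thesis
    using cmat_obj[of k] cmat_obj[of l]
    by (auto simp: vec2_eq_iff[of _ _ "label k"])
qed

lemma length_Phi [simp]: "length (Phi C 1 a) = half"
  by (simp add: Phi_def half_def)

lemma Phi_nth: "k < half \<Longrightarrow> Phi C 1 a ! k = cc (int k)"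
  by (simp add: Phi_def half_def[symmetric] cc_nat)

end

lemma period_add_mult:
  fixes f :: "int \<Rightarrow> 'b"
  assumes "\<And>j. f (j + p) = f j"
  shows "f (j + p * t) = f j"
proof (induction t rule: int_induct[of _ 0])
  case base
  then show ?case by simp
next
  case (step1 i)
  then show ?case using assms[of "j + p * i"] by (simp add: algebra_simps)
next
  case (step2 i)
  then show ?case using assms[of "j + p * (i - 1)"] by (simp add: algebra_simps)
qed


section \<open>Repetitions\<close>

text \<open>Up to the factor \<open>z 1\<close> these are Chebyshev polynomials of the second kind.
  If r exceeded 3, positivity of \<open>z 2\<close> would force t > 0, that of \<open>z 3\<close>,
  which is (t^2 - 1) times \<open>z 1\<close>, would exclude t = 1, and for t \<ge> 2 the sequence
  increases and never returns to 0.\<close>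

lemma chebyshev_zero_le_3:
  fixes z :: "nat \<Rightarrow> int"
  assumes z0: "z 0 = 0" and rec: "\<And>k. z (Suc (Suc k)) = t * z (Suc k) - z k"
    and pos: "\<And>k. 0 < k \<Longrightarrow> k < r \<Longrightarrow> z k > 0" and zr: "z r = 0" and "r > 0"
  shows "r \<in> {1, 2, 3}"
proof (rule ccontr)
  assume "r \<notin> {1, 2, 3}"
  then have r: "r > 3" using \<open>r > 0\<close> by auto
  have z1: "z 1 > 0" and z2: "z 2 > 0" and z3: "z 3 > 0" using pos r by auto
  have e2: "z 2 = t * z 1" using rec[of 0] z0 by (simp add: numeral_2_eq_2)
  have e3: "z 3 = t * z 2 - z 1" using rec[of 1] by (simp add: numeral_2_eq_2 numeral_3_eq_3)
  have "t > 0" using e2 z1 z2 by (simp add: zero_less_mult_iff)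
  moreover have "t \<noteq> 1" using e2 e3 z3 by auto
  ultimately have t: "t \<ge> 2" by simp
  have "z k \<ge> 0 \<and> z (Suc k) > z k" for k
  proof (induction k)
    case 0
    then show ?case using z0 z1 by simp
  next
    case (Suc k)
    have "t * z (Suc k) \<ge> 2 * z (Suc k)" using t Suc by (intro mult_right_mono) auto
    then show ?case using Suc rec[of k] by linarith
  qed
  from this[of "r - 1"] have "z r > 0" using r by (simp add: less_le_trans le_less_trans)
  then show False using zr by simp
qed

lemma length_seq_pow [simp]: "length (seq_pow d r) = r * length d"
  by (simp add: seq_pow_def length_concat sum_list_replicate)

lemma seq_pow_nth: "k < r * length d \<Longrightarrow> seq_pow d r ! k = d ! (k mod length d)"
proof (induction r arbitrary: k)
  case (Suc r)
  show ?case
  proof (cases "k < length d")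
    case False
    then have "seq_pow d (Suc r) ! k = seq_pow d r ! (k - length d)"
      by (simp add: seq_pow_def nth_append)
    also have "\<dots> = d ! ((k - length d) mod length d)" using False Suc by simp
    finally show ?thesis using False by (simp add: le_mod_geq)
  qed (simp add: seq_pow_def nth_append)
qed simp

context based_cscheme
begin

lemma repetition_le_3:
  assumes m: "m > 0" and half: "m * r = half" and periodic: "\<And>j. cc (j + int m) = cc j"
  shows "r \<in> {1, 2, 3}"
proof -
  define u where "u k = walk_root C 1 a k $ 1" for k
  define v where "v k = walk_root C 1 a k $ 2" for k
  have other1: "other 1 = (2 :: 2)" by (simp add: other_def)
  have rec: "u (Suc (Suc k)) = cc (int (Suc k)) * u (Suc k) - u k"
    "v (Suc (Suc k)) = cc (int (Suc k)) * v (Suc k) - v k" for k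
    unfolding u_def v_def cc_nat by (simp_all add: walk_root_Suc_Suc[OF base])
  have init: "u 0 = 1" "v 0 = 0" "u (Suc 0) = cc 0" "v (Suc 0) = 1"
    using \<alpha>_nth[of 1] \<alpha>_nth[of 2] walk_root_1[OF base, of 1] cc_nat[of 0]
    by (simp_all add: u_def v_def other1 other_def)
  \<comment> \<open>The shifted sequence solves the same recursion, so it is a combination of
    \<open>u\<close> and \<open>v\<close>, whose values at 0 and 1 are 1, \<open>cc 0\<close> and 0,
    1. Its value at 0 is the coefficient \<open>f m\<close> of \<open>u\<close>; its value at 1 then
    leaves \<open>A f\<close> for \<open>v\<close>.\<close>
  define A where "A f = f (Suc m) - f m * cc 0" for f :: "nat \<Rightarrow> int"
  have shift: "f (k + m) = A f * v k + f m * u k \<and> f (Suc k + m) = A f * v (Suc k) + f m * u (Suc k)"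
    if f: "\<And>k. f (Suc (Suc k)) = cc (int (Suc k)) * f (Suc k) - f k" for f k
  proof (induction k)
    case 0
    then show ?case by (simp add: init A_def)
  next
    case (Suc k)
    have "cc (int (Suc (k + m))) = cc (int (Suc k))" using periodic[of "int (Suc k)"] by (simp add: add_ac)
    then have "f (Suc (Suc k) + m) = cc (int (Suc k)) * f (Suc k + m) - f (k + m)"
      using f[of "k + m"] by simp
    also have "\<dots> = A f * v (Suc (Suc k)) + f m * u (Suc (Suc k))"
      unfolding rec conjunct1[OF Suc] conjunct2[OF Suc] by (simp add: algebra_simps)
    finally show ?case using Suc by blast
  qed
  have v_shift: "v (k + m) = A v * v k + v m * u k" for k using shift[of v] rec by blast
  have u_shift: "u (k + m) = A u * v k + u m * u k" for k using shift[of u] rec by blast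
  have "u m * v (Suc m) - v m * u (Suc m) = 1"
    using walk_root_casorati[OF base, of 1 m] by (simp add: u_def v_def other1)
  then have det: "A v * u m - v m * A u = 1" by (simp add: A_def algebra_simps)
  show ?thesis
  proof (rule chebyshev_zero_le_3)
    show "v (0 * m) = 0" by (simp add: init)
    \<comment> \<open>Cayley-Hamilton for the shift by m, a 2x2 matrix of trace
      \<open>A v + u m\<close> and determinant 1.\<close>
    show "v (Suc (Suc k) * m) = (A v + u m) * v (Suc k * m) - v (k * m)" for k
    proof -
      have "v (k * m + m + m) = A v * v (k * m + m) + v m * (A u * v (k * m) + u m * u (k * m))"
        by (simp add: v_shift u_shift)
      also have "\<dots> = (A v + u m) * v (k * m + m) - (A v * u m - v m * A u) * v (k * m)"
        unfolding v_shift[of "k * m"] by (simp add: algebra_simps)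
      finally show ?thesis by (simp add: det add_ac)
    qed
    \<comment> \<open>Root 0 is (1, 0), so its determinant with another root is the second
      coordinate of that root.\<close>
    show "v (k * m) > 0" if "0 < k" "k < r" for k
    proof -
      have "k * m < half" using that m half by (metis mult.commute mult_less_mono1)
      moreover have "0 < k * m" using that m by simp
      moreover have "walk_root C 1 a j \<in> nonneg_vecs" if "j \<le> k * m" for j
        using walk_root_pos(1)[OF base] that calculation card_pos_roots[OF base] by simp
      ultimately have "walk_root C 1 a 0 $ 1 * walk_root C 1 a (k * m) $ other 1
          - walk_root C 1 a 0 $ other 1 * walk_root C 1 a (k * m) $ 1 > 0"
        by (intro walk_root_pos_det[OF base, of "k * m"]) auto
      moreover have "\<alpha> 1 $ 2 = (0 :: int)" using \<alpha>_nth(2)[of 1] by (simp add: other1)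
      ultimately show ?thesis by (simp add: v_def other1)
    qed
    show "v (r * m) = 0"
      using walk_root_pos(3)[OF base, of 1] \<alpha>_nth(2)[of 1] half
      by (simp add: v_def card_pos_roots[OF base] mult.commute other1)
    show "r > 0" using half half_ge_2 by (cases r) auto
  qed
qed


section \<open>Symmetries of the cycle\<close>

text \<open>A rotation for e = 1, a reflection for e = -1. The restriction to \<open>objs C\<close>
  is there because the elements of \<open>BijGroup\<close> are extensional.\<close>

definition symm :: "int \<Rightarrow> int \<Rightarrow> 'a \<Rightarrow> 'a" where
  "symm e s = (\<lambda>b\<in>objs C. obj (e * int (position C a b) + s))"

lemma obj_position:
  assumes "b \<in> objs C"
  shows "obj (int (position C a b)) = b"
proof -
  obtain k where "walk C 1 a k = b" using objs_eq_walk[OF base, of 1] assms by auto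
  then show ?thesis unfolding obj_nat position_def by (rule LeastI)
qed

lemma symm_obj [simp]: "symm e s (obj k) = obj (e * k + s)"
proof -
  have "int (position C a (obj k)) mod period = k mod period"
    using obj_position[of "obj k"] obj_eq_iff by simp
  then have "(e * int (position C a (obj k)) + s) mod period = (e * k + s) mod period"
    by (metis mod_add_cong mod_mult_cong)
  then show ?thesis by (simp add: symm_def obj_eq_iff)
qed

lemma symm_extensional: "symm e s \<in> extensional (objs C)"
  by (simp add: symm_def)

lemma symm_eqI: "(\<And>k. f (obj k) = obj (e * k + s)) \<Longrightarrow> f \<in> extensional (objs C) \<Longrightarrow> f = symm e s"
  using objs_eq by (intro extensionalityI[OF _ symm_extensional]) auto

lemma symm_eq_iff:
  assumes "e \<in> {1, -1}" "e' \<in> {1, -1}"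
  shows "symm e s = symm e' s' \<longleftrightarrow> e = e' \<and> s mod period = s' mod period"
proof
  assume eq: "symm e s = symm e' s'"
  have s: "s mod period = s' mod period"
    using fun_cong[OF eq, of "obj 0"] unfolding symm_obj obj_eq_iff by simp
  have "(e + s) mod period = (e' + s') mod period"
    using fun_cong[OF eq, of "obj 1"] unfolding symm_obj obj_eq_iff by simp
  then have "(e + s - s) mod period = (e' + s' - s') mod period" using s by (rule mod_diff_cong)
  then have "period dvd e - e'" by (simp add: mod_eq_dvd_iff)
  \<comment> \<open>On a cycle of two vertices k and -k would agree; here the length is at least 4,
    while the signs differ by at most 2.\<close>
  moreover have "\<bar>e - e'\<bar> < period" using assms half_ge_2 by auto
  ultimately have "e = e'" using zdvd_not_zless[of "\<bar>e - e'\<bar>" period] by auto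
  then show "e = e' \<and> s mod period = s' mod period" using s by simp
next
  assume "e = e' \<and> s mod period = s' mod period"
  then show "symm e s = symm e' s'"
    by (intro symm_eqI symm_extensional) (auto simp: obj_eq_iff intro: mod_add_cong)
qed

lemma compose_symm: "compose (objs C) (symm e s) (symm e' s') = symm (e * e') (e * s' + s)"
  by (rule symm_eqI) (simp_all add: compose_def algebra_simps)

lemma symm_1_0: "symm 1 0 = (\<lambda>b\<in>objs C. b)"
  by (rule symm_eqI[symmetric]) auto

lemma symm_Bij:
  assumes "e \<in> {1, -1}"
  shows "symm e s \<in> Bij (objs C)"
proof -
  have "symm e (- (e * s)) (symm e s b) = b" "symm e s (symm e (- (e * s)) b) = b" if "b \<in> objs C" for b
    using that assms unfolding objs_eq by auto
  moreover have "symm e' s' b \<in> objs C" if "b \<in> objs C" for e' s' b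
    using that unfolding objs_eq by auto
  ultimately have "bij_betw (symm e s) (objs C) (objs C)"
    by (intro bij_betwI[of _ _ _ "symm e (- (e * s))"]) auto
  then show ?thesis by (simp add: Bij_def symm_extensional)
qed

section \<open>The symmetries as permutations, and the group H\<close>

abbreviation B :: "('a \<Rightarrow> 'a) monoid" where
  "B \<equiv> BijGroup (objs C)"

lemma symm_in_B [simp]: "e \<in> {1, -1} \<Longrightarrow> symm e s \<in> carrier B"
  using symm_Bij by (simp add: BijGroup_def)

lemma one_B: "\<one>\<^bsub>B\<^esub> = symm 1 0"
  by (simp add: BijGroup_def symm_1_0)

lemma mult_B:
  "e \<in> {1, -1} \<Longrightarrow> e' \<in> {1, -1} \<Longrightarrow> symm e s \<otimes>\<^bsub>B\<^esub> symm e' s' = symm (e * e') (e * s' + s)"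
  using symm_Bij compose_symm by (simp add: BijGroup_def)

lemma inv_B: 
  assumes "e \<in> {1, -1}"
  shows "inv\<^bsub>B\<^esub> symm e s = symm e (- (e * s))"
  using assms by (intro group.inv_equality[OF group_BijGroup]) (auto simp: mult_B one_B)

lemma symm_pow_B: "symm 1 s [^]\<^bsub>B\<^esub> (k :: nat) = symm 1 (s * int k)"
proof (induction k)
  case 0
  then show ?case by (simp add: one_B)
next
  case (Suc k)
  then show ?case by (simp add: mult_B algebra_simps)
qed

lemma symm_int_pow_B: "symm 1 s [^]\<^bsub>B\<^esub> (k :: int) = symm 1 (s * k)"
proof (cases "k < 0")
  case True
  then have "symm 1 s [^]\<^bsub>B\<^esub> k = inv\<^bsub>B\<^esub> symm 1 (s * int (nat (- k)))"
    by (simp only: int_pow_def2 if_True symm_pow_B)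
  also have "\<dots> = symm 1 (- (1 * (s * int (nat (- k)))))" by (rule inv_B) simp
  finally show ?thesis using True by simp
next
  case False
  then have "symm 1 s [^]\<^bsub>B\<^esub> k = symm 1 (s * int (nat k))"
    by (simp only: int_pow_def2 if_False symm_pow_B)
  then show ?thesis using False by simp
qed

lemma \<mu>_eq: "\<mu> C a = symm 1 1"
  unfolding \<mu>_def symm_def by (rule restrict_ext) (metis obj_nat of_nat_Suc add.commute mult_1)

text \<open>From \<open>a\<close> the edge labelled 1 leads to \<open>obj 1\<close>, so a walk
  beginning with label 2 runs round the cycle the other way.\<close>

lemma walk_2: "walk C 2 a k = obj (- int k)"
proof (induction k)
  case (Suc k)
  have "alt 2 k = other (label (- int k))" by (simp add: alt_def label_def other_def)
  then show ?case using rho_other_label[of "- int k"] Suc by (simp add: minus_diff_commute)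
qed simp

lemma \<tau>_eq: "\<tau> C a = symm (-1) 0"
  unfolding \<tau>_def symm_def by (rule restrict_ext) (simp add: walk_2)

lemma H_set_eq: "H_set C a = {symm 1 s | s. even s} \<union> {symm (-1) s | s. odd s}"
proof -
  have "{\<mu> C a [^]\<^bsub>B\<^esub> (2 * k) | k :: int. True} = {symm 1 s | s. even s}"
    by (auto simp: \<mu>_eq symm_int_pow_B elim!: evenE)
  moreover have "{\<tau> C a \<otimes>\<^bsub>B\<^esub> \<mu> C a [^]\<^bsub>B\<^esub> (2 * k + 1) | k :: int. True} = {symm (-1) s | s. odd s}"
    (is "?L = ?R")
  proof (intro equalityI subsetI)
    fix g assume "g \<in> ?R"
    then obtain s where "g = symm (-1) s" "odd s" by blast
    \<comment> \<open>Reflecting after a rotation by 2k + 1 produces the shift -(2k + 1).\<close>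
    moreover from this obtain k where "s = - (2 * k) - 1"
      by (metis add.inverse_inverse even_minus oddE minus_add_distrib diff_conv_add_uminus)
    ultimately have "g = \<tau> C a \<otimes>\<^bsub>B\<^esub> \<mu> C a [^]\<^bsub>B\<^esub> (2 * k + 1)"
      by (simp add: \<mu>_eq \<tau>_eq symm_int_pow_B mult_B)
    then show "g \<in> ?L" by blast
  qed (auto simp: \<mu>_eq \<tau>_eq symm_int_pow_B mult_B)
  ultimately show ?thesis unfolding H_set_def Let_def by simp
qed

lemma H_cases:
  assumes "g \<in> H_set C a"
  obtains e s where "g = symm e s" "e \<in> {1, -1}" "even s \<longleftrightarrow> e = 1"
  using assms unfolding H_set_eq by auto

lemma symm_in_H: "e \<in> {1, -1} \<Longrightarrow> (even s \<longleftrightarrow> e = 1) \<Longrightarrow> symm e s \<in> H_set C a"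
  unfolding H_set_eq by auto

lemma subgroup_H: "subgroup (H_set C a) B"
proof (rule group.subgroupI[OF group_BijGroup])
  show "H_set C a \<subseteq> carrier B" unfolding H_set_eq by auto
  show "H_set C a \<noteq> {}" unfolding H_set_eq by auto
next
  fix g assume "g \<in> H_set C a"
  then obtain e s where g: "g = symm e s" "e \<in> {1, -1}" "even s \<longleftrightarrow> e = 1" by (rule H_cases)
  show "inv\<^bsub>B\<^esub> g \<in> H_set C a" unfolding g(1) inv_B[OF g(2)] using g by (intro symm_in_H) auto
next
  fix g h assume "g \<in> H_set C a" "h \<in> H_set C a"
  then obtain e s e' s' where gh: "g = symm e s" "e \<in> {1, -1}" "even s \<longleftrightarrow> e = 1"
      "h = symm e' s'" "e' \<in> {1, -1}" "even s' \<longleftrightarrow> e' = 1" by (metis H_cases)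
  show "g \<otimes>\<^bsub>B\<^esub> h \<in> H_set C a"
    unfolding gh(1,4) mult_B[OF gh(2,5)] using gh by (intro symm_in_H) auto
qed

lemma H_closed: "g \<in> H_set C a \<Longrightarrow> b \<in> objs C \<Longrightarrow> g b \<in> objs C"
  by (erule H_cases) (auto simp: symm_def)

text \<open>An edge is labelled by the parity of its lower index. Rotations in H shift that index by
  an even number; a reflection sends the edge k, k + 1 to the edge s - k - 1, s - k, and s - k - 1
  has the parity of k because s is odd.\<close>

lemma H_rho:
  assumes "g \<in> H_set C a" "b \<in> objs C"
  shows "g (rho C i b) = rho C i (g b)"
proof -
  obtain e s where g: "g = symm e s" "e \<in> {1, -1}" "even s \<longleftrightarrow> e = 1" using assms(1) by (rule H_cases)
  obtain k where k: "b = obj k" using assms(2) unfolding objs_eq by blast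
  have l: "label (e * k + s) = (if e = 1 then label k else other (label k))"
    using g by (auto simp: label_def other_def)
  have r1: "rho C (label k) (obj (e * k + s)) = obj (e * (k + 1) + s)"
    using rho_label[of "e * k + s"] rho_other_label[of "e * k + s"] g(2) unfolding l
    by (auto simp: algebra_simps)
  have r2: "rho C (other (label k)) (obj (e * k + s)) = obj (e * (k - 1) + s)"
    using rho_label[of "e * k + s"] rho_other_label[of "e * k + s"] g(2) unfolding l
    by (auto simp: algebra_simps)
  show ?thesis
    using index_cases[of i "label k"] by (auto simp: k g(1) rho_label rho_other_label r1 r2)
qed

text \<open>The image of \<open>a\<close> gives the shift modulo 2n, and its parity tells rotations
  from reflections. With \<open>H_transitive\<close>, H acts simply transitively on the
  objects.\<close>

lemma H_eq_iff:
  assumes "g \<in> H_set C a" "h \<in> H_set C a" "g a = h a"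
  shows "g = h"
proof -
  obtain e s e' s' where gh: "g = symm e s" "e \<in> {1, -1}" "even s \<longleftrightarrow> e = 1"
      "h = symm e' s'" "e' \<in> {1, -1}" "even s' \<longleftrightarrow> e' = 1" using assms(1,2) by (metis H_cases)
  have s: "s mod period = s' mod period"
    using assms(3) symm_obj[of e s 0] symm_obj[of e' s' 0] obj_eq_iff gh by simp
  then have "even s \<longleftrightarrow> even s'" by (metis dvd_triv_left dvd_mod_iff)
  then have "e = e'" using gh by auto
  then show ?thesis using gh s symm_eq_iff by blast
qed

lemma H_transitive:
  assumes "b \<in> objs C"
  shows "\<exists>g\<in>H_set C a. g a = b"
proof -
  obtain k where k: "b = obj k" using assms unfolding objs_eq by blast
  show ?thesis
  proof (rule bexI)
    show "symm (if even k then 1 else -1) k \<in> H_set C a" by (rule symm_in_H) auto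
    show "symm (if even k then 1 else -1) k a = b"
      using symm_obj[of "if even k then 1 else -1" k 0] k by simp
  qed
qed

end


section \<open>Coverings and deck transformations\<close>

lemma scheme_coveringD:
  assumes "scheme_covering C D q"
  shows "cartan C" "cartan D" "q \<in> objs C \<rightarrow> objs D"
    and "\<And>x. x \<in> objs C \<Longrightarrow> cmat D (q x) = cmat C x"
    and "\<And>i x. x \<in> objs C \<Longrightarrow> q (rho C i x) = rho D i (q x)"
  using assms unfolding scheme_covering_def cartan_def by blast+

context finite_cscheme
begin

lemma Hom_unique: 
  assumes "(b, f) \<in> Hom C x" "(b, g) \<in> Hom C x"
  shows "f = g"
proof -
  obtain h where h: "(x, h) \<in> Hom C b" "h \<circ> f = id" "f \<circ> h = id" using Hom_inverse[OF assms(1)] by blast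
  have "h \<circ> g = id" using Hom_comp[OF h(1) assms(2)] by (rule Hom_self)
  then have "f \<circ> (h \<circ> g) = f" by simp
  then show ?thesis using h(3) by (simp add: comp_assoc[symmetric])
qed

text \<open>A priori one linear map may join several pairs of objects. For the identity this is
  excluded by closing it up with a walk: the walk morphism becomes an endomorphism, hence the
  identity, so the walk consists of full turns.\<close>

lemma Hom_id_eq:
  assumes "(b, id) \<in> Hom C x"
  shows "b = x"
proof -
  have b: "b \<in> objs C" and x: "x \<in> objs C" using assms Hom_target Hom_source by blast+
  obtain k where k: "b = walk C 1 x k" using objs_eq_walk[OF x, of 1] b by blast
  have "(x, walk_mor C 1 x k \<circ> id) \<in> Hom C x"
    using Hom_comp[OF Hom_walk[OF x, of 1 k]] assms unfolding k .
  then have "walk_mor C 1 x k = id" using Hom_self by fastforce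
  then show ?thesis using walk_mor_eq_id[OF x] walk_eq_self[OF x] k by blast
qed

lemma Hom_same_target:
  assumes "(x, f) \<in> Hom C b" "(x, f) \<in> Hom C b'"
  shows "b = b'"
proof -
  obtain g where g: "(b, g) \<in> Hom C x" "g \<circ> f = id" using Hom_inverse[OF assms(1)] by blast
  have "(b, g \<circ> f) \<in> Hom C b'" by (rule Hom_comp[OF g(1) assms(2)])
  then show ?thesis using Hom_id_eq g(2) by simp
qed

end

context based_cscheme
begin

lemma deck_to_End_eq:
  assumes "(a, f) \<in> Hom C (g a)"
  shows "deck_to_End C a g = f"
  unfolding deck_to_End_def weyl_hom_def using assms Hom_unique by (intro the_equality) auto

lemma deck_to_End_Hom:
  assumes "g \<in> H_set C a"
  shows "(a, deck_to_End C a g) \<in> Hom C (g a)"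
proof -
  obtain f where "(a, f) \<in> Hom C (g a)"
    using connected H_closed[OF assms base] base unfolding connected_scheme_def weyl_hom_def by blast
  then show ?thesis using deck_to_End_eq by metis
qed

text \<open>The linear map determines its source \<open>g a\<close>, and \<open>g a\<close>
  determines \<open>g\<close>.\<close>

lemma inj_on_deck_to_End: "inj_on (deck_to_End C a) (H_set C a)"
  by (rule inj_onI) (metis H_eq_iff Hom_same_target deck_to_End_Hom)

definition cartan_symmetries :: "('a \<Rightarrow> 'a) set" where
  "cartan_symmetries = {g \<in> H_set C a. \<forall>b\<in>objs C. cmat C (g b) = cmat C b}"

lemma deck_set_subset:
  assumes "scheme_covering C D q"
  shows "deck_set C a q \<subseteq> cartan_symmetries"
proof
  fix g assume "g \<in> deck_set C a q"
  then have H: "g \<in> H_set C a" and g: "\<And>b. b \<in> objs C \<Longrightarrow> q (g b) = q b"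
    by (simp_all add: deck_set_def)
  have "cmat C (g b) = cmat C b" if "b \<in> objs C" for b
    using scheme_coveringD(4)[OF assms H_closed[OF H that]] scheme_coveringD(4)[OF assms that] g[OF that]
    by simp
  then show "g \<in> cartan_symmetries" using H by (simp add: cartan_symmetries_def)
qed

text \<open>Both \<open>q\<close> and its composite with \<open>g\<close> commute with all
  \<open>rho\<close>, so agreement at \<open>a\<close> spreads along paths to every object.\<close>

lemma deck_setI:
  assumes q: "scheme_covering C D q" and "g \<in> H_set C a" "q (g a) = q a"
  shows "g \<in> deck_set C a q"
proof -
  have "q (g b) = q b" if "(b, f) \<in> Hom C a" for b f
    using that
  proof (induction b f rule: Hom.induct)
    case Hom_id
    then show ?case using assms by simp
  next
    case (Hom_step b f i)
    then have "b \<in> objs C" "g b \<in> objs C" using Hom_target H_closed assms(2) by blast+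
    then show ?case
      using Hom_step scheme_coveringD(5)[OF q] H_rho[OF assms(2)] by metis
  qed
  moreover have "\<exists>f. (b, f) \<in> Hom C a" if "b \<in> objs C" for b
    using connected that base unfolding connected_scheme_def weyl_hom_def by blast
  ultimately show ?thesis using assms(2) unfolding deck_set_def by blast
qed

lemma mult_deck:
  assumes "g \<in> H_set C a" "h \<in> H_set C a" "b \<in> objs C"
  shows "(g \<otimes>\<^bsub>B\<^esub> h) b = g (h b)"
proof -
  have "g \<in> carrier B" "h \<in> carrier B" using assms subgroup.subset[OF subgroup_H] by blast+
  then show ?thesis using assms by (simp add: BijGroup_def compose_eq)
qed

lemma subgroup_deck_set: "subgroup (deck_set C a q) B"
proof (rule group.subgroupI[OF group_BijGroup])
  have H: "subgroup (H_set C a) B" by (rule subgroup_H)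
  have sub: "deck_set C a q \<subseteq> H_set C a" by (auto simp: deck_set_def)
  show "deck_set C a q \<subseteq> carrier B" using sub subgroup.subset[OF H] by blast
  have "\<one>\<^bsub>B\<^esub> \<in> deck_set C a q"
    using subgroup.one_closed[OF H] by (auto simp: deck_set_def BijGroup_def)
  then show "deck_set C a q \<noteq> {}" by blast
next
  fix g assume g: "g \<in> deck_set C a q"
  have H: "subgroup (H_set C a) B" by (rule subgroup_H)
  have gB: "g \<in> carrier B" using g subgroup.subset[OF H] by (auto simp: deck_set_def)
  have gi: "inv\<^bsub>B\<^esub> g \<in> H_set C a" using g subgroup.m_inv_closed[OF H] by (auto simp: deck_set_def)
  have "g \<in> H_set C a" using g by (simp add: deck_set_def)
  then have inv: "g ((inv\<^bsub>B\<^esub> g) b) = b" if "b \<in> objs C" for b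
    using mult_deck[OF _ gi that] group.r_inv[OF group_BijGroup gB] that by (metis one_B symm_1_0 restrict_apply')
  have "q ((inv\<^bsub>B\<^esub> g) b) = q b" if "b \<in> objs C" for b
  proof -
    have "q (g ((inv\<^bsub>B\<^esub> g) b)) = q ((inv\<^bsub>B\<^esub> g) b)"
      using g H_closed[OF gi that] by (simp add: deck_set_def)
    then show ?thesis using inv that by simp
  qed
  then show "inv\<^bsub>B\<^esub> g \<in> deck_set C a q" using gi by (simp add: deck_set_def)
next
  fix g h assume gh: "g \<in> deck_set C a q" "h \<in> deck_set C a q"
  have H: "subgroup (H_set C a) B" by (rule subgroup_H)
  have "g \<in> carrier B" "h \<in> carrier B"
    using gh subgroup.subset[OF H] by (auto simp: deck_set_def)
  then have m: "g \<otimes>\<^bsub>B\<^esub> h = compose (objs C) g h" by (simp add: BijGroup_def)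
  have "g \<otimes>\<^bsub>B\<^esub> h \<in> H_set C a" using gh subgroup.m_closed[OF H] by (auto simp: deck_set_def)
  then show "g \<otimes>\<^bsub>B\<^esub> h \<in> deck_set C a q"
    using gh H_closed unfolding m by (auto simp: deck_set_def compose_eq)
qed

lemma deck_to_End_iso:
  assumes q: "scheme_covering C D q"
  shows "deck_to_End C a \<in> iso (deck_group C a q) (weyl_End D (q a))"
proof (rule isoI)
  note cov = scheme_coveringD[OF q]
  have H: "g \<in> H_set C a" if "g \<in> deck_set C a q" for g using that by (simp add: deck_set_def)
  have closed: "deck_to_End C a g \<in> weyl_hom D (q a) (q a)" if g: "g \<in> deck_set C a q" for g
  proof -
    have "(q a, deck_to_End C a g) \<in> Hom D (q (g a))"
      by (rule Hom_map[OF cov(1) deck_to_End_Hom[OF H[OF g]] cov(3-5)])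
    then show ?thesis using g base by (simp add: deck_set_def weyl_hom_def)
  qed
  show "deck_to_End C a \<in> hom (deck_group C a q) (weyl_End D (q a))"
  proof (rule homI)
    fix g h assume gh: "g \<in> carrier (deck_group C a q)" "h \<in> carrier (deck_group C a q)"
    then have g: "g \<in> deck_set C a q" and h: "h \<in> deck_set C a q" by (auto simp: deck_group_def)
    \<comment> \<open>Since \<open>g\<close> preserves Cartan matrices and labels, it transports the
      morphism of \<open>h\<close> as the same linear map; its target \<open>g a\<close> is where
      the morphism of \<open>g\<close> starts.\<close>
    have "(g a, deck_to_End C a h) \<in> Hom C (g (h a))"
    proof (rule Hom_map[OF cov(1) deck_to_End_Hom[OF H[OF h]]])
      show "g \<in> objs C \<rightarrow> objs C" using H_closed[OF H[OF g]] by blast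
      show "cmat C (g x) = cmat C x" if "x \<in> objs C" for x
        using deck_set_subset[OF q] g that by (auto simp: cartan_symmetries_def)
      show "g (rho C i x) = rho C i (g x)" if "x \<in> objs C" for i x
        using H_rho[OF H[OF g] that] .
    qed
    from Hom_comp[OF deck_to_End_Hom[OF H[OF g]] this]
    have "(a, deck_to_End C a g \<circ> deck_to_End C a h) \<in> Hom C ((g \<otimes>\<^bsub>B\<^esub> h) a)"
      using mult_deck[OF H[OF g] H[OF h] base] by simp
    then show "deck_to_End C a (g \<otimes>\<^bsub>deck_group C a q\<^esub> h)
        = deck_to_End C a g \<otimes>\<^bsub>weyl_End D (q a)\<^esub> deck_to_End C a h"
      by (simp add: deck_to_End_eq deck_group_def weyl_End_def)
  qed (auto simp: deck_group_def weyl_End_def closed)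
  show "bij_betw (deck_to_End C a) (carrier (deck_group C a q)) (carrier (weyl_End D (q a)))"
  proof (rule bij_betw_imageI)
    show "inj_on (deck_to_End C a) (carrier (deck_group C a q))"
      by (rule inj_on_subset[OF inj_on_deck_to_End]) (auto simp: deck_group_def H)
    have "\<exists>g\<in>deck_set C a q. deck_to_End C a g = f" if f: "(q a, f) \<in> Hom D (q a)" for f
    proof -
      \<comment> \<open>Paths lift from the prescribed start \<open>a\<close>, but
        \<open>deck_to_End\<close> uses morphisms ending in \<open>a\<close>; hence the inverse of
        \<open>f\<close> is lifted and the lift inverted.\<close>
      obtain f' where f': "(q a, f') \<in> Hom D (q a)" "f' \<circ> f = id" "f \<circ> f' = id"
        using cartan.Hom_inverse[OF cov(2) f] by blast
      obtain b where b: "q b = q a" "(b, f') \<in> Hom C a"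
        using Hom_lift[OF cov(1) f'(1) refl base cov(4,5)] by blast
      obtain h where h: "(a, h) \<in> Hom C b" "h \<circ> f' = id" using Hom_inverse[OF b(2)] by blast
      have "h \<circ> (f' \<circ> f) = f" using h(2) by (simp add: comp_assoc[symmetric])
      then have hf: "h = f" using f'(2) by simp
      have "b \<in> objs C" using Hom_target[OF b(2)] .
      then obtain g where g: "g \<in> H_set C a" "g a = b" using H_transitive by blast
      then have "g \<in> deck_set C a q" using deck_setI[OF q] b(1) by simp
      moreover have "deck_to_End C a g = f" using deck_to_End_eq h(1) g(2) hf by simp
      ultimately show ?thesis by blast
    qed
    then show "deck_to_End C a ` carrier (deck_group C a q) = carrier (weyl_End D (q a))"
      using closed by (fastforce simp: deck_group_def weyl_End_def weyl_hom_def)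
  qed
qed

end


subsection \<open>The universal quotient\<close>

context finite_cscheme
begin

text \<open>The coarsest covering: it identifies as many objects as the Cartan matrices allow.\<close>

definition same_future :: "'a \<Rightarrow> 'a \<Rightarrow> bool" where
  "same_future b b' \<longleftrightarrow> (\<forall>w. cmat C (fold (rho C) w b) = cmat C (fold (rho C) w b'))"

text \<open>A representative instead of the equivalence class keeps the quotient over the type
  \<open>'a\<close>, so that it is among the coverings compared in
  \<open>maximal_covering\<close>.\<close>

definition quot :: "'a \<Rightarrow> 'a" where
  "quot b = (SOME b'. b' \<in> objs C \<and> same_future b b')"

definition quot_scheme :: "'a cscheme" where
  "quot_scheme = \<lparr>objs = quot ` objs C, rho = (\<lambda>i b. quot (rho C i b)), cmat = cmat C\<rparr>"

lemma same_future_refl: "same_future b b"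
  by (simp add: same_future_def)

lemma quot: 
  assumes "b \<in> objs C"
  shows "quot b \<in> objs C" "same_future b (quot b)"
  using someI[of "\<lambda>b'. b' \<in> objs C \<and> same_future b b'" b] assms same_future_refl
  unfolding quot_def by blast+

lemma quot_cong: "same_future b b' \<Longrightarrow> quot b = quot b'"
  unfolding quot_def same_future_def by simp

lemma same_future_rho: "same_future b b' \<Longrightarrow> same_future (rho C i b) (rho C i b')"
  unfolding same_future_def by (metis fold_simps(2))

lemma cmat_quot: "b \<in> objs C \<Longrightarrow> cmat C (quot b) = cmat C b"
  using quot(2)[of b] unfolding same_future_def by (metis fold_simps(1))

lemma quot_rho: "b \<in> objs C \<Longrightarrow> quot (rho C i (quot b)) = quot (rho C i b)"
  using quot_cong[OF same_future_rho[OF quot(2)]] by metis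

lemma quot_covering: "scheme_covering C quot_scheme quot"
proof -
  have "cartan_scheme quot_scheme"
    unfolding cartan_scheme_def
  proof (intro conjI allI ballI)
    show "objs quot_scheme \<noteq> {}" using cartan by (auto simp: quot_scheme_def cartan_scheme_def)
    show "rho quot_scheme i \<in> objs quot_scheme \<rightarrow> objs quot_scheme" for i
      by (auto simp: quot_scheme_def quot(1))
    fix b assume "b \<in> objs quot_scheme"
    then obtain x where x: "x \<in> objs C" "b = quot x" by (auto simp: quot_scheme_def)
    have b: "b \<in> objs C" using x quot(1) by simp
    show "gen_cartan_matrix (cmat quot_scheme b)"
      using b cartan by (simp add: quot_scheme_def cartan_scheme_def)
    show "rho quot_scheme i (rho quot_scheme i b) = b" for i
      using x by (simp add: quot_scheme_def quot_rho)
    show "cmat quot_scheme b $ i $ j = cmat quot_scheme (rho quot_scheme i b) $ i $ j" for i j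
      using b by (simp add: quot_scheme_def cmat_quot cmat_rho)
  qed
  moreover have map: "(quot b, f) \<in> Hom quot_scheme (quot x)" if "(b, f) \<in> Hom C x" for b f x
    by (rule Hom_map[OF _ that])
      (auto simp: cartan_axioms quot_scheme_def cmat_quot quot_rho)
  then have "connected_scheme quot_scheme"
    using connected unfolding connected_scheme_def weyl_hom_def quot_scheme_def
    by (auto simp: quot_scheme_def) blast
  ultimately show ?thesis
    using cartan connected unfolding scheme_covering_def
    by (auto simp: quot_scheme_def cmat_quot quot_rho)
qed

end

context based_cscheme
begin

text \<open>An element of H commutes with every \<open>rho\<close>; if it preserves the matrix at
  each object, it preserves the matrices along every word, and the quotient identifies its
  orbits.\<close>

lemma deck_set_quot: "deck_set C a quot = cartan_symmetries"
proof
  show "deck_set C a quot \<subseteq> cartan_symmetries" by (rule deck_set_subset[OF quot_covering])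
  show "cartan_symmetries \<subseteq> deck_set C a quot"
  proof
    fix g assume g: "g \<in> cartan_symmetries"
    then have H: "g \<in> H_set C a" by (simp add: cartan_symmetries_def)
    have "fold (rho C) w (g b) = g (fold (rho C) w b) \<and> fold (rho C) w b \<in> objs C"
      if "b \<in> objs C" for w b
      using that by (induction w arbitrary: b) (auto simp: H_rho[OF H, symmetric])
    then have "same_future (g b) b" if "b \<in> objs C" for b
      using g that by (simp add: same_future_def cartan_symmetries_def)
    then show "g \<in> deck_set C a quot" using H quot_cong by (simp add: deck_set_def)
  qed
qed

lemma deck_to_End_image:
  assumes "scheme_covering C D q"
  shows "deck_to_End C a ` deck_set C a q = weyl_hom D (q a) (q a)"
  using deck_to_End_iso[OF assms] by (simp add: iso_def bij_betw_def deck_group_def weyl_End_def)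

text \<open>All deck sets lie in \<open>cartan_symmetries\<close>, and the quotient attains this
  bound. So the End group of \<open>p\<close> lies in that of the quotient, maximality makes them
  equal, and injectivity of \<open>deck_to_End\<close> pulls the equality back to H.\<close>

lemma deck_set_maximal:
  assumes p: "maximal_covering C C' p a"
  shows "deck_set C a p = cartan_symmetries"
proof -
  have cov: "scheme_covering C C' p" using p by (simp add: maximal_covering_def)
  have sub: "deck_set C a p \<subseteq> cartan_symmetries" by (rule deck_set_subset[OF cov])
  have im: "deck_to_End C a ` cartan_symmetries = weyl_hom quot_scheme (quot a) (quot a)"
    using deck_to_End_image[OF quot_covering] unfolding deck_set_quot .
  have "weyl_hom C' (p a) (p a) \<subseteq> weyl_hom quot_scheme (quot a) (quot a)"
    unfolding im[symmetric] deck_to_End_image[OF cov, symmetric] using sub by (rule image_mono)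
  then have "weyl_hom quot_scheme (quot a) (quot a) = weyl_hom C' (p a) (p a)"
    using p quot_covering unfolding maximal_covering_def by blast
  then have "deck_to_End C a ` cartan_symmetries = deck_to_End C a ` deck_set C a p"
    unfolding im deck_to_End_image[OF cov] .
  moreover have "cartan_symmetries \<subseteq> H_set C a" by (auto simp: cartan_symmetries_def)
  ultimately show ?thesis
    using sub inj_on_image_eq_iff[OF inj_on_deck_to_End] by (metis dual_order.trans)
qed

end


section \<open>Cyclic and dihedral groups of symmetries\<close>

text \<open>The isomorphisms below start from the model groups, where elements are explicit, and
  have to be inverted. Asking only for closure spares the group axioms for
  \<open>dihedral\<close>.\<close>

lemma is_iso_sym_closed:
  assumes h: "h \<in> iso G K" and closed: "\<And>x y. x \<in> carrier G \<Longrightarrow> y \<in> carrier G \<Longrightarrow> x \<otimes>\<^bsub>G\<^esub> y \<in> carrier G"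
  shows "K \<cong> G"
proof -
  let ?i = "inv_into (carrier G) h"
  have bij: "bij_betw h (carrier G) (carrier K)"
    and mult: "\<And>x y. x \<in> carrier G \<Longrightarrow> y \<in> carrier G \<Longrightarrow> h (x \<otimes>\<^bsub>G\<^esub> y) = h x \<otimes>\<^bsub>K\<^esub> h y"
    using h by (auto simp: iso_def hom_def)
  have i: "?i x \<in> carrier G" "h (?i x) = x" if "x \<in> carrier K" for x
    using bij that by (auto simp: bij_betw_def inv_into_into f_inv_into_f)
  have "?i (x \<otimes>\<^bsub>K\<^esub> y) = ?i x \<otimes>\<^bsub>G\<^esub> ?i y" if "x \<in> carrier K" "y \<in> carrier K" for x y
  proof -
    have "x \<otimes>\<^bsub>K\<^esub> y = h (?i x \<otimes>\<^bsub>G\<^esub> ?i y)" using mult i that by simp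
    moreover have "?i x \<otimes>\<^bsub>G\<^esub> ?i y \<in> carrier G" using closed i that by blast
    ultimately show ?thesis using bij by (simp add: bij_betw_def)
  qed
  then have "?i \<in> iso K G"
    using bij_betw_inv_into[OF bij] i(1) by (intro isoI homI) auto
  then show ?thesis by (auto simp: is_iso_def)
qed

lemma dihedral_closed:
  "N > 0 \<Longrightarrow> x \<in> carrier (dihedral N) \<Longrightarrow> y \<in> carrier (dihedral N)
    \<Longrightarrow> x \<otimes>\<^bsub>dihedral N\<^esub> y \<in> carrier (dihedral N)"
  by (auto simp: dihedral_def carrier_integer_mod_group)

lemma dihedral_1: "dihedral 1 \<cong> Z 2"
proof -
  have "snd \<in> iso (dihedral 1) (Z 2)"
    by (rule isoI) (auto simp: dihedral_def carrier_integer_mod_group hom_def bij_betw_def inj_on_def image_iff)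
  then show ?thesis by (auto simp: is_iso_def)
qed

text \<open>Inversion is trivial modulo 2, so the semidirect product is direct.\<close>

lemma dihedral_2: "dihedral 2 \<cong> Z 2 \<times>\<times> Z 2"
proof -
  have "(x - y) mod 2 = (x + y) mod (2 :: int)" for x y by presburger
  then have "id \<in> iso (dihedral 2) (Z 2 \<times>\<times> Z 2)"
    by (intro isoI) (auto simp: dihedral_def hom_def DirProd_def carrier_integer_mod_group)
  then show ?thesis by (auto simp: is_iso_def)
qed

context based_cscheme
begin

lemma symm_mod:
  assumes "M * N = period" "e \<in> {1, -1}"
  shows "symm e (M * (t mod N) + s) = symm e (M * t + s)"
  using assms(2) unfolding symm_eq_iff[OF assms(2) assms(2)] mult_mod_right assms(1) by (simp add: mod_simps)

lemma rotations_cong_cyclic: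
  assumes MN: "M * int N = period"
  shows "B\<lparr>carrier := {symm 1 s | s. M dvd s}\<rparr> \<cong> Z N"
proof (rule is_iso_sym_closed)
  have N: "N > 0" and M: "M \<noteq> 0" using MN half_ge_2 by (auto intro: Nat.gr0I)
  note red = symm_mod[OF MN, of 1 _ 0, simplified]
  show "(\<lambda>x. symm 1 (M * x)) \<in> iso (Z N) (B\<lparr>carrier := {symm 1 s | s. M dvd s}\<rparr>)"
  proof (rule isoI)
    show "(\<lambda>x. symm 1 (M * x)) \<in> hom (Z N) (B\<lparr>carrier := {symm 1 s | s. M dvd s}\<rparr>)"
      by (rule homI) (auto simp: mult_B red algebra_simps)
    have "inj_on (\<lambda>x. symm 1 (M * x)) {0..<int N}"
    proof (rule inj_onI)
      fix x y assume xy: "x \<in> {0..<int N}" "y \<in> {0..<int N}" "symm 1 (M * x) = symm 1 (M * y)"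
      then have "M * (x mod int N) = M * (y mod int N)"
        unfolding mult_mod_right MN by (simp add: symm_eq_iff)
      then show "x = y" using xy M by simp
    qed
    moreover have "(\<lambda>x. symm 1 (M * x)) ` {0..<int N} = {symm 1 s | s. M dvd s}"
    proof (intro equalityI subsetI)
      fix g assume "g \<in> {symm 1 s | s. M dvd s}"
      then obtain t where "g = symm 1 (M * t)" by (auto simp: dvd_def)
      then have "g = symm 1 (M * (t mod int N))" by (simp add: red)
      moreover have "t mod int N \<in> {0..<int N}" using N by simp
      ultimately show "g \<in> (\<lambda>x. symm 1 (M * x)) ` {0..<int N}" by (rule image_eqI)
    qed auto
    ultimately show "bij_betw (\<lambda>x. symm 1 (M * x)) (carrier (Z N)) (carrier (B\<lparr>carrier := {symm 1 s | s. M dvd s}\<rparr>))"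
      using N by (simp add: bij_betw_def carrier_integer_mod_group)
  qed
  show "x \<otimes>\<^bsub>Z N\<^esub> y \<in> carrier (Z N)" if "x \<in> carrier (Z N)" "y \<in> carrier (Z N)" for x y
    using N by (simp add: carrier_integer_mod_group)
qed

text \<open>Following the single reflection of shift \<open>s0\<close> by the rotations through
  multiples of \<open>M\<close> gives all reflections of the set.\<close>

lemma symmetries_cong_dihedral:
  assumes MN: "M * int N = period"
  shows "B\<lparr>carrier := {symm 1 s | s. M dvd s} \<union> {symm (-1) s | s. M dvd s - s0}\<rparr> \<cong> dihedral N"
    (is "?G \<cong> _")
proof (rule is_iso_sym_closed)
  have N: "N > 0" and M: "M \<noteq> 0" using MN half_ge_2 by (auto intro: Nat.gr0I)
  \<comment> \<open>The second component marks reflections. A reflection on the left reverses the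
    rotation to its right, which is the \<open>x - y\<close> in \<open>dihedral\<close>.\<close>
  define h where "h = (\<lambda>(x, t :: int). if t = 0 then symm 1 (M * x) else symm (-1) (M * x + s0))"
  note red1 = symm_mod[OF MN, of 1 _ 0, simplified]
  note red2 = symm_mod[OF MN, of "-1" _ s0, simplified]
  have carrier: "carrier (dihedral N) = {0..<int N} \<times> {0, 1}"
    using N by (auto simp: dihedral_def carrier_integer_mod_group)
  show "h \<in> iso (dihedral N) ?G"
  proof (rule isoI)
    show "h \<in> hom (dihedral N) ?G"
    proof (rule homI)
      fix p assume "p \<in> carrier (dihedral N)"
      then show "h p \<in> carrier ?G" unfolding carrier by (auto simp: h_def)
    next
      fix p q assume "p \<in> carrier (dihedral N)" "q \<in> carrier (dihedral N)"
      then obtain x t y u where p: "p = (x, t)" "t \<in> {0, 1}" and q: "q = (y, u)" "u \<in> {0, 1}"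
        unfolding carrier by auto
      have "p \<otimes>\<^bsub>dihedral N\<^esub> q = ((if t = 0 then x + y else x - y) mod int N, (t + u) mod 2)"
        by (simp add: dihedral_def p q)
      then show "h (p \<otimes>\<^bsub>dihedral N\<^esub> q) = h p \<otimes>\<^bsub>?G\<^esub> h q"
        using p(2) q(2) by (auto simp: p(1) q(1) h_def mult_B red1 red2) (simp_all add: algebra_simps)
    qed
    have "inj_on h ({0..<int N} \<times> {0, 1})"
    proof (rule inj_onI)
      fix p q assume pq: "p \<in> {0..<int N} \<times> {0, 1}" "q \<in> {0..<int N} \<times> {0, 1}" "h p = h q"
      obtain x t y u where xy: "p = (x, t)" "q = (y, u)" by (metis surj_pair)
      have t: "t = u" using pq by (auto simp: h_def xy symm_eq_iff split: if_splits)
      have "(M * x) mod period = (M * y) mod period"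
      proof (cases "u = 0")
        case False
        then have "(M * x + s0) mod period = (M * y + s0) mod period"
          using pq t by (simp add: h_def xy symm_eq_iff)
        from mod_diff_cong[OF this refl, of s0] show ?thesis by simp
      qed (use pq t in \<open>simp add: h_def xy symm_eq_iff\<close>)
      then have "M * (x mod int N) = M * (y mod int N)" unfolding mult_mod_right MN .
      then show "p = q" using pq M xy t by simp
    qed
    moreover have "h ` ({0..<int N} \<times> {0, 1}) = {symm 1 s | s. M dvd s} \<union> {symm (-1) s | s. M dvd s - s0}"
    proof (intro equalityI subsetI)
      fix g assume "g \<in> {symm 1 s | s. M dvd s} \<union> {symm (-1) s | s. M dvd s - s0}"
      then consider t where "g = symm 1 (M * t)" | s t where "g = symm (-1) s" "s - s0 = M * t"
        by (auto simp: dvd_def)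
      then show "g \<in> h ` ({0..<int N} \<times> {0, 1})"
      proof cases
        case (1 t)
        then have "g = h (t mod int N, 0)" by (simp add: h_def red1)
        then show ?thesis using N by (intro image_eqI) auto
      next
        case (2 s t)
        then have "g = symm (-1) (M * t + s0)" by (simp add: algebra_simps)
        then have "g = h (t mod int N, 1)" by (simp add: h_def red2)
        then show ?thesis using N by (intro image_eqI) auto
      qed
    qed (auto simp: h_def split: if_splits)
    ultimately show "bij_betw h (carrier (dihedral N)) (carrier ?G)"
      unfolding carrier by (simp add: bij_betw_def)
  qed
qed (use MN half_ge_2 in \<open>auto intro!: dihedral_closed Nat.gr0I\<close>)

lemma generate_\<mu>_pow: "generate B {\<mu> C a [^]\<^bsub>B\<^esub> (k :: nat)} = {symm 1 s | s. int k dvd s}"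
proof -
  have "generate B {symm 1 (int k)} = {symm 1 (int k * t) | t. True}"
    using group.generate_pow[OF group_BijGroup, of "symm 1 (int k)"] by (simp add: symm_int_pow_B)
  then show ?thesis unfolding \<mu>_eq symm_pow_B by (auto simp: dvd_def)
qed


section \<open>Symmetries of the sequence\<close>

text \<open>The matrix at vertex k holds the values of the edges k - 1 and k, so letting k vary
  tests every edge. Sending vertex k to s - k sends edge j to edge s - 1 - j; for odd s the centre
  (s - 1) / 2 is an integer, so the sequence is reflected about an entry.\<close>

lemma cartan_symmetries_eq:
  "cartan_symmetries = {symm 1 s | s. even s \<and> (\<forall>j. cc (j + s) = cc j)}
    \<union> {symm (-1) s | s. odd s \<and> (\<forall>j. cc (s - 1 - j) = cc j)}"
proof -
  have inv: "(\<forall>b\<in>objs C. cmat C (symm e s b) = cmat C b) \<longleftrightarrow> (\<forall>k. cmat C (obj (e * k + s)) = cmat C (obj k))" for e s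
    unfolding objs_eq by simp
  have rot: "(\<forall>b\<in>objs C. cmat C (symm 1 s b) = cmat C b) \<longleftrightarrow> (\<forall>j. cc (j + s) = cc j)" if "even s" for s
  proof -
    have "cmat C (obj (1 * k + s)) = cmat C (obj k) \<longleftrightarrow> cc (k + s) = cc k \<and> cc (k - 1 + s) = cc (k - 1)" for k
      using cmat_obj_eq_even[of "k + s" k] that by (simp add: algebra_simps)
    then show ?thesis unfolding inv by blast
  qed
  have refl_iff: "(\<forall>b\<in>objs C. cmat C (symm (-1) s b) = cmat C b) \<longleftrightarrow> (\<forall>j. cc (s - 1 - j) = cc j)" if "odd s" for s
  proof -
    have "cmat C (obj (-1 * k + s)) = cmat C (obj k)
        \<longleftrightarrow> cc (s - 1 - (k - 1)) = cc (k - 1) \<and> cc (s - 1 - k) = cc k" for k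
      using cmat_obj_eq_odd[of "- k + s" k] that by (simp add: algebra_simps)
    then show ?thesis unfolding inv by blast
  qed
  have "cartan_symmetries = {symm 1 s | s. even s \<and> (\<forall>b\<in>objs C. cmat C (symm 1 s b) = cmat C b)}
      \<union> {symm (-1) s | s. odd s \<and> (\<forall>b\<in>objs C. cmat C (symm (-1) s b) = cmat C b)}"
    unfolding cartan_symmetries_def H_set_eq by blast
  moreover have "{symm 1 s | s. even s \<and> (\<forall>b\<in>objs C. cmat C (symm 1 s b) = cmat C b)}
      = {symm 1 s | s. even s \<and> (\<forall>j. cc (j + s) = cc j)}" by (intro Collect_cong ex_cong1 conj_cong refl rot)
  moreover have "{symm (-1) s | s. odd s \<and> (\<forall>b\<in>objs C. cmat C (symm (-1) s b) = cmat C b)}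
      = {symm (-1) s | s. odd s \<and> (\<forall>j. cc (s - 1 - j) = cc j)}" by (intro Collect_cong ex_cong1 conj_cong refl refl_iff)
  ultimately show ?thesis by simp
qed

lemma cc_add_half_mult: "cc (k + int half * t) = cc k"
  using period_add_mult[of cc "int half"] cc_add_half by blast

lemma Phi_nth_mod: "Phi C 1 a ! (k mod half) = cc (int k)"
proof -
  have "k mod half < half" using half_ge_2 by simp
  moreover have "int k = int (k mod half) + int half * int (k div half)"
    by (metis mod_mult_div_eq of_nat_add of_nat_mult)
  ultimately show ?thesis using Phi_nth cc_add_half_mult by metis
qed

text \<open>With its 1-based position k, the type 1 condition says that \<open>cc\<close> is
  symmetric about the index k - 1, which is the reflection with s = 2k - 1. Conversely the centre (s
  - 1) / 2 is moved into range by the period n.\<close>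

lemma type1_Phi: "type1 (Phi C 1 a) \<longleftrightarrow> (\<exists>s. odd s \<and> (\<forall>j. cc (s - 1 - j) = cc j))"
proof -
  let ?c = "Phi C 1 a"
  have h: "half > 0" using half_ge_2 by simp
  have rot: "rotate (k - 1) ?c = rev (rotate k ?c) \<longleftrightarrow> (\<forall>j. cc (int k - 1 + j) = cc (int k - 1 - j))"
    if k: "k \<ge> 1" for k
  proof -
    have l: "rotate (k - 1) ?c ! j = cc (int k - 1 + int j)" if "j < half" for j
    proof -
      have "rotate (k - 1) ?c ! j = ?c ! ((k - 1 + j) mod half)" using that by (simp add: nth_rotate)
      also have "\<dots> = cc (int (k - 1 + j))" by (rule Phi_nth_mod)
      also have "int (k - 1 + j) = int k - 1 + int j" using k by simp
      finally show ?thesis .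
    qed
    have r: "rev (rotate k ?c) ! j = cc (int k - 1 - int j)" if "j < half" for j
    proof -
      have "rev (rotate k ?c) ! j = cc (int (k + (half - Suc j)))"
        using that Phi_nth_mod[of "k + (half - Suc j)"] by (simp add: nth_rotate rev_nth)
      also have "int (k + (half - Suc j)) = (int k - 1 - int j) + int half"
        using that by simp
      finally show ?thesis by (simp only: cc_add_half)
    qed
    have "rotate (k - 1) ?c = rev (rotate k ?c)
        \<longleftrightarrow> (\<forall>j<half. cc (int k - 1 + int j) = cc (int k - 1 - int j))"
      by (simp add: list_eq_iff_nth_eq l[unfolded One_nat_def] r)
    also have "\<dots> \<longleftrightarrow> (\<forall>j. cc (int k - 1 + j) = cc (int k - 1 - j))"
    proof (intro iffI allI)
      fix j assume *: "\<forall>j<half. cc (int k - 1 + int j) = cc (int k - 1 - int j)"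
      obtain i where i: "j mod int half = int i" "i < half"
        using h by (metis int_ops(1) nat_int_comparison(2) pos_mod_bound pos_mod_sign zero_le_imp_eq_int)
      have j: "j = int i + int half * (j div int half)" using i by (metis mod_mult_div_eq)
      have "cc (int k - 1 + j) = cc (int k - 1 + int i)"
        using cc_add_half_mult[of "int k - 1 + int i" "j div int half"] j by (simp add: add.assoc)
      moreover have "cc (int k - 1 - j) = cc (int k - 1 - int i)"
        using cc_add_half_mult[of "int k - 1 - int i" "- (j div int half)"] j by (simp add: algebra_simps)
      ultimately show "cc (int k - 1 + j) = cc (int k - 1 - j)" using * i by simp
    qed auto
    finally show ?thesis .
  qed
  show ?thesis
  proof
    assume "type1 ?c"
    then obtain k where k: "k \<ge> 1" "rotate (k - 1) ?c = rev (rotate k ?c)" by (auto simp: type1_def)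
    then have *: "cc (int k - 1 + j) = cc (int k - 1 - j)" for j using rot by blast
    have "cc (2 * int k - 1 - 1 - j) = cc j" for j
      using *[of "int k - 1 - j"] by (simp add: algebra_simps)
    then show "\<exists>s. odd s \<and> (\<forall>j. cc (s - 1 - j) = cc j)" by (intro exI[of _ "2 * int k - 1"]) auto
  next
    assume "\<exists>s. odd s \<and> (\<forall>j. cc (s - 1 - j) = cc j)"
    then obtain s where s: "odd s" "\<forall>j. cc (s - 1 - j) = cc j" by blast
    then obtain t where "s = 2 * t + 1" by (elim oddE)
    then have t: "cc (2 * t - j) = cc j" for j using s by simp
    define k where "k = Suc (nat (t mod int half))"
    have "int k - 1 = t mod int half" using h by (simp add: k_def)
    then have k: "int k - 1 = t + int half * (- (t div int half))"
      using minus_mult_div_eq_mod[of t "int half"] by simp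
    have "cc (int k - 1 + j) = cc (int k - 1 - j)" for j
      using cc_add_half_mult[of "t + j" "- (t div int half)"] cc_add_half_mult[of "t - j" "- (t div int half)"]
        t[of "t - j"] unfolding k by (simp add: algebra_simps)
    moreover have "k \<in> {1..half}" using h by (simp add: k_def Suc_le_eq nat_less_iff)
    ultimately show "type1 ?c" unfolding type1_def length_Phi using rot by (intro bexI[of _ k]) auto
  qed
qed

text \<open>By Bezout the periods s and \<open>length d\<close> combine to their gcd g. The sequence
  is then a power of its first g entries with exponent rq, where \<open>length d\<close> is gq, so
  maximality of r gives q = 1 and g = \<open>length d\<close>.\<close>

lemma cc_periods:
  assumes c: "Phi C 1 a = seq_pow d r" and max: "\<And>d' r'. Phi C 1 a = seq_pow d' r' \<Longrightarrow> r' \<le> r"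
  shows "(\<forall>j. cc (j + s) = cc j) \<longleftrightarrow> int (length d) dvd s"
proof -
  let ?m = "length d"
  have half: "half = r * ?m" using arg_cong[OF c, of length] by simp
  have m: "?m > 0" and r: "r > 0" using half half_ge_2 by (auto intro: Nat.gr0I)
  have per: "cc (j + int ?m) = cc j" for j
  proof -
    have d: "cc (int k) = d ! (k mod ?m)" for k
    proof -
      have "k mod half < r * ?m" unfolding half[symmetric] using half_ge_2 by simp
      then have "cc (int k) = d ! (k mod half mod ?m)"
        using seq_pow_nth Phi_nth_mod[of k] unfolding c by metis
      then show ?thesis by (simp add: half mod_mod_cancel)
    qed
    define t where "t = nat (j mod int half)"
    have t: "j = int t + int half * (j div int half)" using half_ge_2 by (simp add: t_def)
    have "cc (j + int ?m) = cc (int (t + ?m) + int half * (j div int half))"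
      by (subst t) (simp add: algebra_simps)
    also have "\<dots> = cc (int t)" unfolding cc_add_half_mult d by simp
    also have "\<dots> = cc j" using cc_add_half_mult[of "int t"] t by metis
    finally show ?thesis .
  qed
  show ?thesis
  proof
    assume "int ?m dvd s"
    then show "\<forall>j. cc (j + s) = cc j" using period_add_mult[of cc "int ?m"] per by (auto simp: dvd_def)
  next
    assume s: "\<forall>j. cc (j + s) = cc j"
    define g where "g = nat (gcd s (int ?m))"
    have g: "int g = gcd s (int ?m)" by (simp add: g_def)
    obtain u v where "u * s + v * int ?m = int g" unfolding g using bezout_int by metis
    then have "cc (j + int g) = cc (j + s * u + int ?m * v)" for j by (simp add: algebra_simps)
    then have gper: "cc (j + int g) = cc j" for j
      using period_add_mult[of cc s _ u] period_add_mult[of cc "int ?m" _ v] s per by simp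
    have "int g dvd int ?m" unfolding g by simp
    then have "g dvd ?m" by simp
    then obtain q where q: "?m = g * q" by (auto simp: dvd_def)
    have gpos: "g > 0" using q m by (cases g) auto
    have hg: "half = (r * q) * g" using half q by simp
    have len: "length (take g (Phi C 1 a)) = g" using hg half_ge_2 by (cases "r * q") auto
    have "Phi C 1 a = seq_pow (take g (Phi C 1 a)) (r * q)"
    proof (rule nth_equalityI)
      show "length (Phi C 1 a) = length (seq_pow (take g (Phi C 1 a)) (r * q))"
        unfolding length_seq_pow len using hg by simp
      fix k assume "k < length (Phi C 1 a)"
      then have k: "k < half" by simp
      have "g \<le> half" using hg half_ge_2 by (cases "r * q") auto
      moreover have "k mod g < g" using gpos by simp
      ultimately have kg: "k mod g < half" "k mod g < g" by linarith+
      have "int k = int (k mod g) + int g * int (k div g)"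
        by (metis mod_mult_div_eq of_nat_add of_nat_mult)
      then have "cc (int k) = cc (int (k mod g))" using period_add_mult[of cc "int g"] gper by metis
      then show "Phi C 1 a ! k = seq_pow (take g (Phi C 1 a)) (r * q) ! k"
        using k kg seq_pow_nth[of k "r * q" "take g (Phi C 1 a)"] hg unfolding len by (simp add: Phi_nth)
    qed
    then have "r * q \<le> r" by (rule max)
    then have "q = 1" using r q m by (cases q) auto
    then have "int ?m = gcd s (int ?m)" using q g by simp
    then show "int ?m dvd s" by (metis gcd_dvd1)
  qed
qed

end


context based_cscheme
begin

text \<open>A rotation must be even and a period, so \<open>M\<close> is the least common multiple
  of 2 and \<open>length d\<close>. Once one reflection symmetry exists, the others differ from it
  by such rotations.\<close>

lemma cartan_symmetries_cases:
  assumes c: "Phi C 1 a = seq_pow d r" and max: "\<And>d' r'. Phi C 1 a = seq_pow d' r' \<Longrightarrow> r' \<le> r"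
    and M: "M = (if even (length d) then length d else 2 * length d)"
  obtains (type2) "type2 (Phi C 1 a)" "cartan_symmetries = {symm 1 s | s. int M dvd s}"
  | (type1) s0 where "type1 (Phi C 1 a)"
      "cartan_symmetries = {symm 1 s | s. int M dvd s} \<union> {symm (-1) s | s. int M dvd s - s0}"
proof -
  have per: "(\<forall>j. cc (j + s) = cc j) \<longleftrightarrow> int (length d) dvd s" for s
    by (rule cc_periods[OF c max])
  have M_dvd: "int M dvd s \<longleftrightarrow> even s \<and> int (length d) dvd s" for s
  proof (cases "even (length d)")
    case True
    then have "even s" if "int (length d) dvd s" using that by (metis dvd_trans even_of_nat)
    then show ?thesis using True M by auto
  next
    case False
    then have "coprime 2 (int (length d))" by (simp add: coprime_commute)
    then have "2 * int (length d) dvd s \<longleftrightarrow> even s \<and> int (length d) dvd s"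
      by (metis divides_mult dvd_mult_left dvd_mult_right)
    then show ?thesis using False M by simp
  qed
  have rot: "{symm 1 s | s. even s \<and> (\<forall>j. cc (j + s) = cc j)} = {symm 1 s | s. int M dvd s}"
    unfolding per M_dvd ..
  show ?thesis
  proof (cases "type1 (Phi C 1 a)")
    case False
    then have refl_empty: "{symm (-1) s | s. odd s \<and> (\<forall>j. cc (s - 1 - j) = cc j)} = {}"
      unfolding type1_Phi by blast
    have "cartan_symmetries = {symm 1 s | s. int M dvd s}"
      unfolding cartan_symmetries_eq rot refl_empty by simp
    then show ?thesis using type2 False by blast
  next
    case True
    then obtain s0 where s0: "odd s0" "\<forall>j. cc (s0 - 1 - j) = cc j" unfolding type1_Phi by blast
    have "(odd s \<and> (\<forall>j. cc (s - 1 - j) = cc j)) = (int M dvd s - s0)" for s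
    proof -
      \<comment> \<open>The reflections of shifts s and s0 compose to the translation by s -
        s0.\<close>
      have "(\<forall>j. cc (s - 1 - j) = cc j) \<longleftrightarrow> (\<forall>j. cc (j + (s - s0)) = cc j)"
      proof (intro iffI allI)
        fix j assume "\<forall>j. cc (s - 1 - j) = cc j"
        from spec[OF this, of "s0 - 1 - j"] spec[OF s0(2), of j] show "cc (j + (s - s0)) = cc j"
          by (simp add: algebra_simps)
      next
        fix j assume "\<forall>j. cc (j + (s - s0)) = cc j"
        from spec[OF this, of "s0 - 1 - j"] spec[OF s0(2), of j] show "cc (s - 1 - j) = cc j"
          by (simp add: algebra_simps)
      qed
      then show ?thesis unfolding per M_dvd using s0(1) by auto
    qed
    then have "cartan_symmetries = {symm 1 s | s. int M dvd s} \<union> {symm (-1) s | s. int M dvd s - s0}"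
      unfolding cartan_symmetries_eq rot by simp
    then show ?thesis using type1[OF True, of s0] by blast
  qed
qed

end

theorem proposition3p12:
  fixes C :: "'a cscheme" and C' :: "'b cscheme" and p :: "'a \<Rightarrow> 'b"
    and a :: 'a and c d :: "int list" and n m r :: nat
  assumes "cartan_scheme C" and "connected_scheme C" and "simply_connected_scheme C"
    and "finite_irreducible_root_system C (real_roots C)"
    and "n = card (objs C) div 2"
    and "a \<in> objs C"
    and "c = Phi C 1 a"
    and "maximal_covering C C' p a"
    and "c = seq_pow d r"
    and "\<forall>d' r'. c = seq_pow d' r' \<longrightarrow> r' \<le> r"
    and "m = length d"
  shows "
    (let G = deck_group C a p;
         B = BijGroup (objs C);
         rot = (\<lambda>k::nat. generate B {\<mu> C a [^]\<^bsub>B\<^esub> k})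
     in r \<in> {1, 2, 3} \<and> m * (2 * r) = card (objs C) \<and>
        subgroup (deck_set C a p) (H_group C a) \<and>
        deck_to_End C a \<in> iso G (weyl_End C' (p a)) \<and>
        (even m \<and> type1 c \<longrightarrow>
           (r = 1 \<longrightarrow> G \<cong> Z 2 \<times>\<times> Z 2) \<and>
           (r = 2 \<longrightarrow> G \<cong> dihedral 4) \<and>
           (r = 3 \<longrightarrow> G \<cong> dihedral 6)) \<and>
        (even m \<and> type2 c \<longrightarrow>
           (r = 1 \<longrightarrow> G \<cong> Z 2 \<and> deck_set C a p = rot n) \<and>
           (r = 2 \<longrightarrow> G \<cong> Z 4 \<and> deck_set C a p = rot (n div 2)) \<and>
           (r = 3 \<longrightarrow> G \<cong> Z 6 \<and> deck_set C a p = rot (n div 3))) \<and>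
        (odd m \<and> type1 c \<longrightarrow>
           (r = 1 \<longrightarrow> G \<cong> Z 2) \<and>
           (r = 2 \<longrightarrow> G \<cong> Z 2 \<times>\<times> Z 2) \<and>
           (r = 3 \<longrightarrow> G \<cong> dihedral 3)) \<and>
        (odd m \<and> type2 c \<longrightarrow>
           (r = 1 \<longrightarrow> deck_set C a p = {\<one>\<^bsub>B\<^esub>}) \<and>
           (r = 2 \<longrightarrow> G \<cong> Z 2 \<and> deck_set C a p = rot n) \<and>
           (r = 3 \<longrightarrow> G \<cong> Z 3 \<and> deck_set C a p = rot (2 * n div 3))))"
proof -
  interpret based_cscheme C a
    using assms by unfold_locales
  have c: "Phi C 1 a = seq_pow d r" and max: "\<And>d' r'. Phi C 1 a = seq_pow d' r' \<Longrightarrow> r' \<le> r"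
    using assms by auto
  have n: "n = half" using assms(5) by (simp add: half_def)
  have nm: "n = m * r" using arg_cong[OF c, of length] assms(11) n by (simp add: mult.commute)
  have m: "m > 0" using nm n half_ge_2 by (intro Nat.gr0I) simp
  have "cc (j + int m) = cc j" for j using cc_periods[OF c max, where s = "int m"] assms(11) by simp
  then have r: "r \<in> {1, 2, 3}" using repetition_le_3[of m r] m nm n by simp
  have card: "m * (2 * r) = card (objs C)" using card_objs_half n nm by simp
  have cov: "scheme_covering C C' p" using assms(8) by (simp add: maximal_covering_def)
  have "subgroup (deck_set C a p) (B\<lparr>carrier := H_set C a\<rparr>)"
    by (rule group.subgroup_incl[OF group_BijGroup subgroup_deck_set subgroup_H]) (auto simp: deck_set_def)
  then have sub: "subgroup (deck_set C a p) (H_group C a)" by (simp add: H_group_def)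
  have iso: "deck_to_End C a \<in> iso (deck_group C a p) (weyl_End C' (p a))"
    by (rule deck_to_End_iso[OF cov])
  \<comment> \<open>The rotations of the deck group will be those through multiples of
    \<open>M\<close>, and \<open>N\<close> is their number, so that \<open>M\<close> times
    \<open>N\<close> is the full turn 2n.\<close>
  define M where "M = (if even m then m else 2 * m)"
  define N where "N = (if even m then 2 * r else r)"
  have MN: "int M * int N = period"
    unfolding M_def N_def n[symmetric] nm by simp
  have deck: "deck_set C a p = cartan_symmetries" by (rule deck_set_maximal[OF assms(8)])
  consider (type2) "type2 c" "deck_set C a p = generate B {\<mu> C a [^]\<^bsub>B\<^esub> M}" "deck_group C a p \<cong> Z N"
    | (type1) "type1 c" "deck_group C a p \<cong> dihedral N"
  proof (rule cartan_symmetries_cases[OF c max M_def[unfolded assms(11)]])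
    assume "type2 (Phi C 1 a)" and eq: "cartan_symmetries = {symm 1 s | s. int M dvd s}"
    moreover have "deck_group C a p \<cong> Z N"
      unfolding deck_group_def deck eq by (rule rotations_cong_cyclic[OF MN])
    moreover have "deck_set C a p = generate B {\<mu> C a [^]\<^bsub>B\<^esub> M}"
      unfolding deck eq generate_\<mu>_pow ..
    ultimately show ?thesis using that(1) assms(7) by blast
  next
    fix s0 assume "type1 (Phi C 1 a)"
      and eq: "cartan_symmetries = {symm 1 s | s. int M dvd s} \<union> {symm (-1) s | s. int M dvd s - s0}"
    moreover have "deck_group C a p \<cong> dihedral N"
      unfolding deck_group_def deck eq by (rule symmetries_cong_dihedral[OF MN])
    ultimately show ?thesis using that(2) assms(7) by blast
  qed
  then show ?thesis
  proof cases
    case type2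
    \<comment> \<open>In this case \<open>M\<close> is 2m = 2n, a full turn, so only the identity
      remains.\<close>
    have "deck_set C a p = {\<one>\<^bsub>B\<^esub>}" if "odd m" "r = 1"
    proof -
      have "int M = period" using that n nm by (simp add: M_def)
      then have "symm 1 s = symm 1 0" if "int M dvd s" for s using that by (simp add: symm_eq_iff)
      then have "{symm 1 s | s. int M dvd s} = {symm 1 0}" using dvd_0_right by blast
      then show ?thesis unfolding type2(2) generate_\<mu>_pow one_B .
    qed
    \<comment> \<open>As n = mr, the divisions by r are exact, and every exponent of
      \<open>\<mu>\<close> in the claim equals \<open>M\<close>.\<close>
    moreover have "n = M \<and> N = 2" if "even m" "r = 1" using that nm by (simp add: M_def N_def)
    moreover have "n div 2 = M \<and> N = 4" if "even m" "r = 2" using that nm by (simp add: M_def N_def)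
    moreover have "n div 3 = M \<and> N = 6" if "even m" "r = 3" using that nm by (simp add: M_def N_def)
    moreover have "n = M \<and> N = 2" if "odd m" "r = 2" using that nm by (simp add: M_def N_def)
    moreover have "2 * n div 3 = M \<and> N = 3" if "odd m" "r = 3" using that nm by (simp add: M_def N_def)
    ultimately show ?thesis
      unfolding Let_def using r card sub iso type2 by metis
  next
    case type1
    have "deck_group C a p \<cong> Z 2 \<times>\<times> Z 2" if "N = 2"
      using iso_trans[OF type1(2)] dihedral_2 unfolding that .
    moreover have "deck_group C a p \<cong> Z 2" if "N = 1"
      using iso_trans[OF type1(2)] dihedral_1 unfolding that .
    moreover have "N = 2" if "even m" "r = 1" using that by (simp add: N_def)
    moreover have "N = 4" if "even m" "r = 2" using that by (simp add: N_def)
    moreover have "N = 6" if "even m" "r = 3" using that by (simp add: N_def)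
    moreover have "N = r" if "odd m" using that by (simp add: N_def)
    ultimately show ?thesis
      unfolding Let_def using r card sub iso type1 by metis
  qed
qed

end
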